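(* Let $d\ge2$ be an integer. For every integer $k\ge0$ and every word $w=w_1\cdots w_k\in\{1,*\}^k$, $$M_d(w)=\sum_{\pi\in\mathrm{ANC}(w)}\left(\prod_{V\in\pi}(-1)^{\frac{|V|}2-1}\,C_{\frac{|V|}2-1}\right)d^{|\pi|},$$ where $M_d(w):=A_d^w(o,o)$ is the $w$-star moment at the root $o$ of the $d$-regular directed tree $T_d$, $\mathrm{ANC}(w)$ is the set of alternating non-crossing partitions of $w$, $|\pi|$ is the number of blocks of $\pi$, and $C_m:=\frac1{m+1}\binom{2m}{m}$ is the $m$-th Catalan number.
   Context: The $d$-regular directed tree $T_d$ is the Cayley graph of the free group $F_d=\langle e_1,\dots,e_d\rangle$: vertices are the elements of $F_d$, with arcs $(v,v e_i)$ for $v\in F_d$, $i\in\{1,\dots,d\}$; the root $o$ is the identity element. $A_d$ denotes its (infinite) adjacency matrix ($A_d(v,v')=1$ if $(v,v')$ is an arc, $0$ otherwise), $A_d^1:=A_d$, and $A_d^*$ is its adjoint (transpose). For $w=w_1\cdots w_k\in\{1,*\}^k$, $$A_d^w(v,v'):=\sum_{\substack{v_0,v_1,\dots,v_k\in T_d\\ v_0=v,\ v_k=v'}}A_d^{w_1}(v_0,v_1)\cdots A_d^{w_k}(v_{k-1},v_k),$$ which for the empty word ($k=0$) equals $1$ if $v=v'$ and $0$ otherwise. Equivalently, $M_d(w)$ is the number of $(i_1,\dots,i_k)\in\{1,\dots,d\}^k$ such that $e_{i_1}^{w_1}\cdots e_{i_k}^{w_k}$ is the identity of $F_d$, where $e_i^1:=e_i$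 and $e_i^*:=e_i^{-1}$. A partition $\pi$ of $[k]=\{1,\dots,k\}$, with associated equivalence relation $\sim_\pi$ (being in the same block), is non-crossing if for all $1\le i_1<i_2<j_1<j_2\le k$, $i_1\sim_\pi j_1$ and $i_2\sim_\pi j_2$ imply $j_1\sim_\pi i_2$. It is an alternating non-crossing partition of $w$, written $\pi\in\mathrm{ANC}(w)$, if it is non-crossing and for every block $V=\{i_1<\dots<i_m\}\in\pi$ the subword $w|_V:=w_{i_1}\cdots w_{i_m}$ is alternating, i.e. of the form $1{*}1{*}\cdots1{*}$ or ${*}1{*}1\cdots{*}1$ (in particular every block has even size). For the empty word, $\mathrm{ANC}(w)$ consists of the single empty partition. *)

theory Defs
  imports
    "HOL-Analysis.Infinite_Sum"
    "HOL-Algebra.Group"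
    "HOL-Library.Disjoint_Sets"
    "Graph_Theory.Pair_Digraph"
begin

section \<open>Free groups\<close>

text \<open>The free group on \<open>S\<close> is realised on freely reduced words; the letter \<open>(s, True)\<close> stands for
  the generator \<open>s\<close> and \<open>(s, False)\<close> for its inverse.\<close>

definition letter_inv :: "'a \<times> bool \<Rightarrow> 'a \<times> bool" where
  "letter_inv x = (fst x, \<not> snd x)"

definition reduced :: "('a \<times> bool) list \<Rightarrow> bool" where
  "reduced u \<longleftrightarrow> successively (\<lambda>x y. y \<noteq> letter_inv x) u"

fun fg_cons :: "'a \<times> bool \<Rightarrow> ('a \<times> bool) list \<Rightarrow> ('a \<times> bool) list" where
  "fg_cons x [] = [x]"
| "fg_cons x (y # ys) = (if y = letter_inv x then ys else x # y # ys)"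

definition free_group :: "'a set \<Rightarrow> ('a \<times> bool) list monoid" where
  "free_group S =
    \<lparr>carrier = {u. set u \<subseteq> S \<times> UNIV \<and> reduced u}, mult = (\<lambda>u v. foldr fg_cons u v), one = []\<rparr>"

definition fg_gen :: "'a \<Rightarrow> ('a \<times> bool) list" where
  "fg_gen s = [(s, True)]"

lemma letter_inv_letter_inv [simp]: "letter_inv (letter_inv x) = x"
  by (simp add: letter_inv_def)

lemma letter_inv_neq [simp]: "letter_inv x \<noteq> x" "x \<noteq> letter_inv x"
  by (auto simp: letter_inv_def prod_eq_iff)

lemma reduced_Nil [simp]: "reduced []"
  and reduced_single [simp]: "reduced [x]"
  by (simp_all add: reduced_def)

lemma reduced_Cons2 [simp]:
  "reduced (x # y # ys) \<longleftrightarrow> y \<noteq> letter_inv x \<and> reduced (y # ys)"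
  by (simp add: reduced_def)

lemma reduced_tl: "reduced (x # xs) \<Longrightarrow> reduced xs"
  by (cases xs) auto

lemma reduced_fg_cons: "reduced v \<Longrightarrow> reduced (fg_cons x v)"
  by (cases v) (auto dest: reduced_tl)

lemma reduced_foldr: "reduced v \<Longrightarrow> reduced (foldr fg_cons u v)"
  by (induction u) (auto intro: reduced_fg_cons)

lemma set_fg_cons: "set (fg_cons x v) \<subseteq> insert x (set v)"
  by (cases v) auto

lemma set_foldr_fg_cons: "set (foldr fg_cons u v) \<subseteq> set u \<union> set v"
  by (induction u) (use set_fg_cons in fastforce)+

lemma fg_cons_cancel: "reduced v \<Longrightarrow> fg_cons x (fg_cons (letter_inv x) v) = v"
  by (cases v; cases "tl v") auto

lemma foldr_fg_cons_cons:
  "reduced v \<Longrightarrow> foldr fg_cons (fg_cons x u) v = fg_cons x (foldr fg_cons u v)"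
  by (cases u) (auto simp: reduced_foldr fg_cons_cancel)

lemma foldr_fg_cons_assoc:
  "reduced v \<Longrightarrow> foldr fg_cons (foldr fg_cons t u) v = foldr fg_cons t (foldr fg_cons u v)"
  by (induction t) (auto simp: foldr_fg_cons_cons)

lemma fg_cons_reduced: "reduced (x # u) \<Longrightarrow> fg_cons x u = x # u"
  by (cases u) auto

lemma foldr_fg_cons_Nil: "reduced u \<Longrightarrow> foldr fg_cons u [] = u"
proof (induction u)
  case (Cons x u)
  then show ?case using fg_cons_reduced[OF Cons.prems] reduced_tl[OF Cons.prems] by simp
qed simp

lemma foldr_fg_cons_inverse:
  "reduced v \<Longrightarrow> foldr fg_cons (rev (map letter_inv u)) (foldr fg_cons u v) = v"
proof (induction u)
  case (Cons x u)
  then show ?case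
    using fg_cons_cancel[OF reduced_foldr[OF Cons.prems], of "letter_inv x" u] by simp
qed simp

lemma group_free_group: "group (free_group S)"
proof (rule groupI, goal_cases)
  case (1 x y)
  then show ?case
    using set_foldr_fg_cons[of x y] by (auto simp: free_group_def reduced_foldr)
next
  case (5 x)
  define y where "y = foldr fg_cons (rev (map letter_inv x)) []"
  have "set y \<subseteq> S \<times> UNIV"
    using 5 set_foldr_fg_cons[of "rev (map letter_inv x)" "[]"]
    by (fastforce simp: y_def free_group_def letter_inv_def)
  moreover have "foldr fg_cons y x = []"
    using 5 foldr_fg_cons_assoc[of x "rev (map letter_inv x)" "[]"]
      foldr_fg_cons_inverse[of "[]" x]
    by (simp add: y_def free_group_def foldr_fg_cons_Nil)
  ultimately show ?case
    by (auto simp: free_group_def y_def reduced_foldr intro!: bexI[of _ y])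
qed (auto simp: free_group_def foldr_fg_cons_assoc)

lemma fg_gen_closed: "s \<in> S \<Longrightarrow> fg_gen s \<in> carrier (free_group S)"
  by (simp add: free_group_def fg_gen_def)

lemma inv_fg_gen:
  assumes "s \<in> S"
  shows "inv\<^bsub>free_group S\<^esub> (fg_gen s) = [(s, False)]"
proof -
  interpret group "free_group S" by (rule group_free_group)
  show ?thesis
    using assms
    by (intro inv_equality) (auto simp: free_group_def fg_gen_def letter_inv_def)
qed

theorem free_group_universal:
  fixes f :: "'a \<Rightarrow> 'b" and G :: "('b, 'm) monoid_scheme"
  assumes "group G" and f: "f \<in> S \<rightarrow> carrier G"
  shows "\<exists>h \<in> hom (free_group S) G. \<forall>s\<in>S. h (fg_gen s) = f s"
    and "\<And>h h' u. \<lbrakk>h \<in> hom (free_group S) G; h' \<in> hom (free_group S) G;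
           \<forall>s\<in>S. h (fg_gen s) = h' (fg_gen s); u \<in> carrier (free_group S)\<rbrakk> \<Longrightarrow> h u = h' u"
proof -
  interpret G: group G by fact
  interpret F: group "free_group S" by (rule group_free_group)
  define l where "l x = (if snd x then f (fst x) else inv\<^bsub>G\<^esub> f (fst x))" for x :: "'a \<times> bool"
  define h where "h u = foldr (\<lambda>x y. l x \<otimes>\<^bsub>G\<^esub> y) u \<one>\<^bsub>G\<^esub>" for u
  have l: "l x \<in> carrier G" if "fst x \<in> S" for x
    using f that by (auto simp: l_def)
  have hc: "h u \<in> carrier G" if "set u \<subseteq> S \<times> UNIV" for u
    using that by (induction u) (auto simp: h_def l)
  have li: "l x \<otimes>\<^bsub>G\<^esub> (l (letter_inv x) \<otimes>\<^bsub>G\<^esub> y) = y"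
    if "fst x \<in> S" "y \<in> carrier G" for x y
    using that f G.r_inv[of "f (fst x)"] G.l_inv[of "f (fst x)"]
    by (auto simp: l_def letter_inv_def G.m_assoc[symmetric] Pi_iff)
  have hcons: "h (fg_cons x u) = l x \<otimes>\<^bsub>G\<^esub> h u"
    if "fst x \<in> S" "set u \<subseteq> S \<times> UNIV" for x u
  proof (cases u)
    case (Cons y ys)
    show ?thesis
    proof (cases "y = letter_inv x")
      case True
      then have "h u = l (letter_inv x) \<otimes>\<^bsub>G\<^esub> h ys" by (simp add: h_def Cons)
      then show ?thesis using True that Cons li[of x "h ys"] hc[of ys] by simp
    qed (simp add: Cons h_def)
  qed (simp add: h_def)
  have hm: "h (foldr fg_cons u v) = h u \<otimes>\<^bsub>G\<^esub> h v"
    if "set u \<subseteq> S \<times> UNIV" "set v \<subseteq> S \<times> UNIV" for u v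
    using that(1)
  proof (induction u)
    case Nil
    then show ?case using hc[OF that(2)] by (simp add: h_def)
  next
    case (Cons x u)
    then have *: "fst x \<in> S" "set u \<subseteq> S \<times> UNIV" by auto
    have "h (fg_cons x (foldr fg_cons u v)) = l x \<otimes>\<^bsub>G\<^esub> h (foldr fg_cons u v)"
      using * that(2) set_foldr_fg_cons[of u v] by (intro hcons) auto
    moreover have "h (x # u) = l x \<otimes>\<^bsub>G\<^esub> h u" by (simp add: h_def)
    ultimately show ?case
      using Cons.IH[OF *(2)] * l[of x] hc[OF *(2)] hc[OF that(2)] by (simp add: G.m_assoc)
  qed
  have "h \<in> hom (free_group S) G"
    using hc hm by (auto simp: hom_def free_group_def)
  moreover have "\<forall>s\<in>S. h (fg_gen s) = f s"
    using f by (auto simp: h_def fg_gen_def l_def Pi_iff)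
  ultimately show "\<exists>h \<in> hom (free_group S) G. \<forall>s\<in>S. h (fg_gen s) = f s" by blast
  fix h h' u
  assume h: "h \<in> hom (free_group S) G" and h': "h' \<in> hom (free_group S) G"
    and eq: "\<forall>s\<in>S. h (fg_gen s) = h' (fg_gen s)" and u: "u \<in> carrier (free_group S)"
  interpret h: group_hom "free_group S" G h by unfold_locales (rule h)
  interpret h': group_hom "free_group S" G h' by unfold_locales (rule h')
  have letter: "h [x] = h' [x]" if "fst x \<in> S" for x
  proof (cases "snd x")
    case True
    then have "[x] = fg_gen (fst x)" by (cases x) (simp add: fg_gen_def)
    then show ?thesis using eq that by simp
  next
    case False
    then have "[x] = inv\<^bsub>free_group S\<^esub> (fg_gen (fst x))"
      using that by (cases x) (simp add: inv_fg_gen)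
    then show ?thesis using eq that by (simp add: fg_gen_closed)
  qed
  show "h u = h' u"
    using u
  proof (induction u)
    case Nil
    then show ?case using h.hom_one h'.hom_one by (simp add: free_group_def)
  next
    case (Cons x u)
    then have u: "u \<in> carrier (free_group S)" and x: "[x] \<in> carrier (free_group S)" "fst x \<in> S"
      by (auto simp: free_group_def dest: reduced_tl)
    have "x # u = [x] \<otimes>\<^bsub>free_group S\<^esub> u"
      using Cons.prems by (simp add: free_group_def fg_cons_reduced)
    then show ?case using Cons.IH[OF u] letter[OF x(2)] u x by simp
  qed
qed


section \<open>The regular directed tree and its star moments\<close>

definition cayley_digraph :: "('a, 'b) monoid_scheme \<Rightarrow> 'a set \<Rightarrow> 'a pair_pre_digraph" where
  "cayley_digraph G S =
    \<lparr>pverts = carrier G, parcs = {(v, v \<otimes>\<^bsub>G\<^esub> s) | v s. v \<in> carrier G \<and> s \<in> S}\<rparr>"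

definition regular_tree :: "nat \<Rightarrow> (nat \<times> bool) list pair_pre_digraph" where
  "regular_tree d = cayley_digraph (free_group {1..d}) (fg_gen ` {1..d})"

definition tree_root :: "nat \<Rightarrow> (nat \<times> bool) list" where
  "tree_root d = \<one>\<^bsub>free_group {1..d}\<^esub>"

datatype star_letter = Plain | Star

definition adjacency :: "'a pair_pre_digraph \<Rightarrow> 'a \<Rightarrow> 'a \<Rightarrow> real" where
  "adjacency G v v' = (if (v, v') \<in> parcs G then 1 else 0)"

fun adjacency_letter :: "'a pair_pre_digraph \<Rightarrow> star_letter \<Rightarrow> 'a \<Rightarrow> 'a \<Rightarrow> real" where
  "adjacency_letter G Plain v v' = adjacency G v v'"
| "adjacency_letter G Star v v' = adjacency G v' v"

text \<open>The vertex set is infinite, so the ordinary \<open>sum\<close> would be the default value \<open>0\<close>;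
  \<open>infsum\<close> is the genuine sum because only finitely many terms are nonzero
  (lemma \<open>regular_tree_finite_support\<close> below).\<close>

definition adjacency_word ::
    "'a pair_pre_digraph \<Rightarrow> star_letter list \<Rightarrow> 'a \<Rightarrow> 'a \<Rightarrow> real" where
  "adjacency_word G w v v' =
    (\<Sum>\<^sub>\<infinity>vs \<in> {vs. length vs = Suc (length w) \<and> set vs \<subseteq> pverts G \<and>
                 vs ! 0 = v \<and> vs ! length w = v'}.
       \<Prod>j<length w. adjacency_letter G (w ! j) (vs ! j) (vs ! Suc j))"

definition star_moment :: "nat \<Rightarrow> star_letter list \<Rightarrow> real" where
  "star_moment d w = adjacency_word (regular_tree d) w (tree_root d) (tree_root d)"

lemma regular_tree_neighbours_finite: "finite {v'. adjacency_letter (regular_tree d) a v v' \<noteq> 0}"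
proof -
  interpret group "free_group {1..d}" by (rule group_free_group)
  let ?F = "free_group {1..d}"
  show ?thesis
  proof (cases a)
    case Plain
    have "{v'. adjacency_letter (regular_tree d) a v v' \<noteq> 0} \<subseteq> (\<lambda>i. v \<otimes>\<^bsub>?F\<^esub> fg_gen i) ` {1..d}"
      by (auto simp: Plain adjacency_def regular_tree_def cayley_digraph_def)
    then show ?thesis by (rule finite_subset) simp
  next
    case Star
    have "{v'. adjacency_letter (regular_tree d) a v v' \<noteq> 0}
        \<subseteq> (\<lambda>i. v \<otimes>\<^bsub>?F\<^esub> inv\<^bsub>?F\<^esub> fg_gen i) ` {1..d}"
    proof
      fix v' assume "v' \<in> {v'. adjacency_letter (regular_tree d) a v v' \<noteq> 0}"
      then obtain i where i: "i \<in> {1..d}" and v': "v' \<in> carrier ?F" "v = v' \<otimes>\<^bsub>?F\<^esub> fg_gen i"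
        unfolding Star adjacency_letter.simps adjacency_def regular_tree_def cayley_digraph_def
        by (auto split: if_splits)
      have "v \<in> carrier ?F" using v' fg_gen_closed[OF i] m_closed by blast
      then have "v' = v \<otimes>\<^bsub>?F\<^esub> inv\<^bsub>?F\<^esub> fg_gen i"
        using v' inv_solve_right[OF v'(1) _ fg_gen_closed[OF i]] by blast
      then show "v' \<in> (\<lambda>i. v \<otimes>\<^bsub>?F\<^esub> inv\<^bsub>?F\<^esub> fg_gen i) ` {1..d}" using i by blast
    qed
    then show ?thesis by (rule finite_subset) simp
  qed
qed

lemma regular_tree_finite_support:
  "finite {vs. length vs = Suc (length w) \<and> vs ! 0 = v \<and>
     (\<Prod>j<length w. adjacency_letter (regular_tree d) (w ! j) (vs ! j) (vs ! Suc j)) \<noteq> 0}"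
  (is "finite (?A w v)")
proof (induction w arbitrary: v)
  case Nil
  have "?A [] v \<subseteq> {[v]}" by (auto simp: length_Suc_conv)
  then show ?case by (rule finite_subset) simp
next
  case (Cons a w)
  let ?N = "{v'. adjacency_letter (regular_tree d) a v v' \<noteq> 0}"
  have "?A (a # w) v \<subseteq> (\<Union>v' \<in> ?N. Cons v ` ?A w v')"
  proof
    fix vs assume vs: "vs \<in> ?A (a # w) v"
    then obtain us where us: "vs = v # us" "length us = Suc (length w)"
      by (cases vs) auto
    have *: "(\<Prod>j<length (a # w).
        adjacency_letter (regular_tree d) ((a # w) ! j) (vs ! j) (vs ! Suc j)) =
      adjacency_letter (regular_tree d) a v (us ! 0) *
        (\<Prod>j<length w. adjacency_letter (regular_tree d) (w ! j) (us ! j) (us ! Suc j))"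
      by (simp add: us prod.lessThan_Suc_shift del: prod.lessThan_Suc)
    have "us ! 0 \<in> ?N" "us \<in> ?A w (us ! 0)"
      using vs us(2) unfolding mem_Collect_eq * by (auto simp del: prod_zero_iff)
    then show "vs \<in> (\<Union>v' \<in> ?N. Cons v ` ?A w v')" using us by blast
  qed
  then show ?case
    using finite_UN_I[OF regular_tree_neighbours_finite finite_imageI[OF Cons.IH]]
    by (rule finite_subset)
qed


section \<open>Alternating non-crossing partitions\<close>

definition same_block :: "'a set set \<Rightarrow> 'a \<Rightarrow> 'a \<Rightarrow> bool" where
  "same_block P i j \<longleftrightarrow> (\<exists>V\<in>P. i \<in> V \<and> j \<in> V)"

definition non_crossing :: "nat \<Rightarrow> nat set set \<Rightarrow> bool" where
  "non_crossing k P \<longleftrightarrow> partition_on {1..k} P \<and>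
    (\<forall>i1 i2 j1 j2. 1 \<le> i1 \<and> i1 < i2 \<and> i2 < j1 \<and> j1 < j2 \<and> j2 \<le> k \<longrightarrow>
       same_block P i1 j1 \<and> same_block P i2 j2 \<longrightarrow> same_block P j1 i2)"

text \<open>Positions in a word are numbered from 1, list positions from 0.\<close>

definition subword :: "'a list \<Rightarrow> nat set \<Rightarrow> 'a list" where
  "subword w V = map (\<lambda>i. w ! (i - 1)) (sorted_list_of_set V)"

definition alternating :: "star_letter list \<Rightarrow> bool" where
  "alternating u \<longleftrightarrow>
    (\<exists>n. u = concat (replicate n [Plain, Star]) \<or> u = concat (replicate n [Star, Plain]))"

definition ANC :: "star_letter list \<Rightarrow> nat set set set" where
  "ANC w = {P. non_crossing (length w) P \<and> (\<forall>V\<in>P. alternating (subword w V))}"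

lemma finite_ANC: "finite (ANC w)"
  by (rule finite_subset[of _ "Pow (Pow {1..length w})"])
    (auto simp: ANC_def non_crossing_def partition_on_def)

definition catalan :: "nat \<Rightarrow> real" where
  "catalan m = 1 / (real m + 1) * real ((2 * m) choose m)"

end

theory Submission
  imports Defs "HOL-Computational_Algebra.Formal_Power_Series"
begin

text \<open>
  The factor \<open>d ^ card P\<close> counts the colourings of the positions by \<open>{1..d}\<close> that are constant on the
  blocks of \<open>P\<close>. Hence it suffices to show, for every fixed word in the letters \<open>e\<^sub>i\<close> and their inverses, that
  the sum of the signed Catalan weights over the non-crossing partitions with monochromatic alternating
  blocks is 1 if the word is trivial in the free group and 0 otherwise. For a reduced nonempty word
  there is no such partition, because two closest points of a block are neighbours in the word. For a
  word with neighbouring inverse letters at \<open>p, q\<close>, the partitions with block \<open>{p, q}\<close> give the sum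
  for the word with these letters cancelled, and the remaining ones contribute 0: a block of size
  \<open>2 n \<ge> 4\<close> containing both \<open>p\<close> and \<open>q\<close> can be cut between them in exactly one admissible
  way into blocks of sizes \<open>2 j\<close> and \<open>2 n - 2 j\<close>, for each \<open>0 < j < n\<close>, and the Catalan recurrence
  makes the weights of these splittings cancel against that of the block.
\<close>

section \<open>Catalan numbers\<close>

text \<open>Weight of a block of size \<open>2 * n\<close>. With half the size as index, the indices
  add up when a block is cut in two, so the Catalan recurrence becomes a convolution without
  shifts.\<close>

definition signed_catalan :: "nat \<Rightarrow> real" where
  "signed_catalan n = (- 1) ^ (n - 1) * catalan (n - 1)"

text \<open>The ratio of consecutive Catalan numbers, from two absorption identities for the central
  binomial coefficient.\<close>

lemma catalan_Suc: "(real m + 2) * catalan (Suc m) = 2 * (2 * real m + 1) * catalan m"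
proof -
  have "Suc m * ((2 * Suc m) choose Suc m) = 2 * (2 * m + 1) * ((2 * m) choose m)"
  proof -
    have a: "Suc m * ((2 * m + 2) choose Suc m) = (2 * m + 2) * ((2 * m + 1) choose m)"
      using Suc_times_binomial_eq[of "2 * m + 1" m] by (simp add: mult.commute)
    have b: "Suc m * ((2 * m + 1) choose m) = (2 * m + 1) * ((2 * m) choose m)"
      using Suc_times_binomial_eq[of "2 * m" m] binomial_symmetric[of m "2 * m + 1"]
      by (simp add: mult.commute)
    have "Suc m * ((2 * m + 2) choose Suc m) = 2 * (Suc m * ((2 * m + 1) choose m))"
      using a by simp
    then show ?thesis unfolding b by simp
  qed
  then have "real (Suc m * ((2 * Suc m) choose Suc m)) = real (2 * (2 * m + 1) * ((2 * m) choose m))"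
    by (rule arg_cong)
  then have "(real m + 1) * real ((2 * Suc m) choose Suc m)
      = 2 * (2 * real m + 1) * real ((2 * m) choose m)"
    by (simp only: of_nat_mult of_nat_add of_nat_Suc) (simp add: algebra_simps)
  moreover have "real ((2 * Suc m) choose Suc m) = (real m + 2) * catalan (Suc m)"
    by (simp add: catalan_def field_simps del: binomial_Suc_Suc)
  moreover have "real ((2 * m) choose m) = (real m + 1) * catalan m"
    by (simp add: catalan_def)
  ultimately have "(real m + 1) * ((real m + 2) * catalan (Suc m))
      = (real m + 1) * (2 * (2 * real m + 1) * catalan m)"
    by (simp only: mult_ac)
  then show ?thesis by (subst (asm) mult_cancel_left) auto
qed

text \<open>Both sides start with 1 and have the same ratio of consecutive terms,
  \<open>- 2 * (2 * m + 1) / (m + 2)\<close>. In generating functions: from degree 1 on, the signed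
  Catalan numbers are the coefficients of (sqrt (1 + 4 x) - 1) / 2.\<close>

lemma signed_catalan_gbinomial: "signed_catalan (Suc m) = 4 ^ Suc m / 2 * ((1/2) gchoose Suc m)"
proof (induction m)
  case 0
  then show ?case by (simp add: signed_catalan_def catalan_def)
next
  case (Suc m)
  have "(real m + 2) * ((1/2::real) gchoose Suc (Suc m)) = (1/2 - (real m + 1)) * ((1/2) gchoose Suc m)"
    using gbinomial_absorb_comp[of "1/2::real" "Suc m"] gbinomial_absorption[of "Suc m" "1/2::real"]
    by (simp add: algebra_simps)
  then have "(real m + 2) * (4 ^ Suc (Suc m) / 2 * ((1/2) gchoose Suc (Suc m)))
      = 4 ^ Suc (Suc m) / 2 * ((1/2 - (real m + 1)) * ((1/2) gchoose Suc m))"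
    by (metis mult.left_commute)
  also have "\<dots> = - 2 * (2 * real m + 1) * (4 ^ Suc m / 2 * ((1/2) gchoose Suc m))"
    by (simp add: algebra_simps)
  also have "\<dots> = - 2 * (2 * real m + 1) * signed_catalan (Suc m)" using Suc by simp
  also have "\<dots> = (real m + 2) * signed_catalan (Suc (Suc m))"
    using arg_cong[OF catalan_Suc[of m], of "\<lambda>x. (- 1) ^ Suc m * x"]
    by (simp add: signed_catalan_def algebra_simps)
  finally show ?case by simp
qed

text \<open>The numbers \<open>1/2 gchoose j\<close> are the Taylor coefficients of \<open>sqrt (1 + x)\<close>, whose square has
  no terms of degree at least 2.\<close>

lemma signed_catalan_convolution:
  assumes "n \<ge> 2"
  shows "(\<Sum>j=1..n-1. signed_catalan j * signed_catalan (n - j)) = - signed_catalan n"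
proof -
  define b where "b j = ((1/2::real) gchoose j)" for j
  have sc: "signed_catalan j = 4 ^ j / 2 * b j" if "j \<ge> 1" for j
    using that signed_catalan_gbinomial[of "j - 1"] by (simp add: b_def)
  have "(\<Sum>j=0..n. b j * b (n - j)) = (1 gchoose n)"
    using gbinomial_Vandermonde[of "1/2::real" "1/2" n] by (simp add: b_def)
  also have "(1 gchoose n :: real) = 0"
    using assms binomial_gbinomial[of 1 n, where ?'a = real] by (simp add: binomial_eq_0)
  \<comment> \<open>Since \<open>b 0 = 1\<close>, each of the two end terms equals
    \<open>b n\<close>; the interior terms form the convolution.\<close>
  also have "{0..n} = insert 0 (insert n {1..n-1})" using assms by auto
  finally have eq: "2 * b n + (\<Sum>j=1..n-1. b j * b (n - j)) = 0"
    using assms by (simp add: b_def[of 0])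
  have "(\<Sum>j=1..n-1. signed_catalan j * signed_catalan (n - j)) = (\<Sum>j=1..n-1. 4 ^ n / 4 * (b j * b (n - j)))"
  proof (rule sum.cong)
    fix j assume "j \<in> {1..n-1}"
    then have "(4::real) ^ j * 4 ^ (n - j) = 4 ^ n" "1 \<le> j" "1 \<le> n - j"
      by (auto simp flip: power_add)
    then show "signed_catalan j * signed_catalan (n - j) = 4 ^ n / 4 * (b j * b (n - j))"
      by (simp add: sc)
  qed simp
  also have "\<dots> = 4 ^ n / 4 * (- 2 * b n)"
    unfolding sum_distrib_left[symmetric] using eq by (metis add_eq_0_iff minus_mult_left mult_minus_left)
  also have "\<dots> = - signed_catalan n" using assms by (simp add: sc)
  finally show ?thesis .
qed

section \<open>Crossing sets\<close>

text \<open>The relation is not symmetric: the smallest of the four points lies in \<open>V\<close>.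
  That two sets do not cross is therefore expressed by two negated statements.\<close>

definition crossing :: "nat set \<Rightarrow> nat set \<Rightarrow> bool" where
  "crossing V W \<longleftrightarrow> (\<exists>a\<in>V. \<exists>b\<in>W. \<exists>c\<in>V. \<exists>d\<in>W. a < b \<and> b < c \<and> c < d)"

lemma crossingI: "a \<in> V \<Longrightarrow> b \<in> W \<Longrightarrow> c \<in> V \<Longrightarrow> d \<in> W \<Longrightarrow> a < b \<Longrightarrow> b < c \<Longrightarrow> c < d \<Longrightarrow> crossing V W"
  unfolding crossing_def by blast

lemma crossing_mono: "crossing V W \<Longrightarrow> V \<subseteq> V' \<Longrightarrow> W \<subseteq> W' \<Longrightarrow> crossing V' W'"
  unfolding crossing_def by blast

definition adjacent_in :: "nat set \<Rightarrow> nat \<Rightarrow> nat \<Rightarrow> bool" where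
  "adjacent_in A p q \<longleftrightarrow> p \<in> A \<and> q \<in> A \<and> p < q \<and> (\<forall>a\<in>A. a \<le> p \<or> q \<le> a)"

text \<open>No point of \<open>X\<close> lies between \<open>p\<close> and \<open>q\<close>, so
  these two are on the same side of every point of \<open>X\<close>. In a crossing that uses one
  point of \<open>V\<close> and one of \<open>W\<close>, one of these can thus be traded for
  \<open>p\<close> or \<open>q\<close>, which leaves a crossing of \<open>X\<close> with
  \<open>V\<close> alone or with \<open>W\<close> alone.\<close>

lemma not_crossing_Un:
  assumes "adjacent_in A p q" "V \<subseteq> A" "W \<subseteq> A" "X \<subseteq> A" "p \<in> V" "q \<in> W" "X \<inter> (V \<union> W) = {}"
    and nc: "\<not> crossing V X" "\<not> crossing X V" "\<not> crossing W X" "\<not> crossing X W"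
  shows "\<not> crossing (V \<union> W) X" "\<not> crossing X (V \<union> W)"
proof -
  have pq: "p < q" "\<And>x. x \<in> X \<Longrightarrow> x < p \<or> q < x"
    using assms by (auto simp: adjacent_in_def) (metis le_less subsetD IntI UnI1 UnI2 empty_iff)
  have V: "\<not> (a < b \<and> b < c \<and> c < d)" "\<not> (b < a \<and> a < d \<and> d < c)" if "a \<in> V" "b \<in> X" "c \<in> V" "d \<in> X" for a b c d
    using crossingI[OF that] crossingI[OF that(2,1,4,3)] nc by blast+
  have W: "\<not> (a < b \<and> b < c \<and> c < d)" "\<not> (b < a \<and> a < d \<and> d < c)" if "a \<in> W" "b \<in> X" "c \<in> W" "d \<in> X" for a b c d
    using crossingI[OF that] crossingI[OF that(2,1,4,3)] nc by blast+
  note p = \<open>p \<in> V\<close> and q = \<open>q \<in> W\<close>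
  show "\<not> crossing (V \<union> W) X"
  proof
    assume "crossing (V \<union> W) X"
    then obtain a b c d where ac: "a \<in> V \<union> W" "c \<in> V \<union> W" and b: "b \<in> X" and d: "d \<in> X"
      and less: "a < b" "b < c" "c < d"
      unfolding crossing_def by auto
    consider "a \<in> V" "c \<in> V" | "a \<in> W" "c \<in> W" | "a \<in> V" "c \<in> W" | "a \<in> W" "c \<in> V" using ac by blast
    then show False
    proof cases
      case 1 then show ?thesis using V(1)[of a b c d] b d less by simp
    next
      case 2 then show ?thesis using W(1)[of a b c d] b d less by simp
    next
      case 3
      then show ?thesis
        using W(2)[OF _ b q d] V(1)[OF _ b p d] W(1)[OF q b _ d] pq(2)[OF b] pq(2)[OF d] pq(1) less
        by (meson less_trans)
    next
      case 4
      then show ?thesis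
        using V(2)[OF _ b p d] W(1)[OF _ b q d] V(1)[OF p b _ d] pq(2)[OF b] pq(2)[OF d] pq(1) less
        by (meson less_trans)
    qed
  qed
  show "\<not> crossing X (V \<union> W)"
  proof
    assume "crossing X (V \<union> W)"
    then obtain a b c d where ac: "a \<in> V \<union> W" "c \<in> V \<union> W" and b: "b \<in> X" and d: "d \<in> X"
      and less: "b < a" "a < d" "d < c"
      unfolding crossing_def by auto
    consider "a \<in> V" "c \<in> V" | "a \<in> W" "c \<in> W" | "a \<in> V" "c \<in> W" | "a \<in> W" "c \<in> V" using ac by blast
    then show False
    proof cases
      case 1 then show ?thesis using V(2)[of a b c d] b d less by simp
    next
      case 2 then show ?thesis using W(2)[of a b c d] b d less by simp
    next
      case 3
      then show ?thesis
        using V(2)[OF _ b p d] W(2)[OF q b _ d] V(1)[OF p b _ d] pq(2)[OF b] pq(2)[OF d] pq(1) less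
        by (meson less_trans)
    next
      case 4
      then show ?thesis
        using W(2)[OF _ b q d] V(2)[OF p b _ d] W(1)[OF q b _ d] pq(2)[OF b] pq(2)[OF d] pq(1) less
        by (meson less_trans)
    qed
  qed
qed

text \<open>Reading the sorted set \<open>B\<close> cyclically from \<open>q\<close> to \<open>p\<close>, the admissible \<open>V\<close> are its final
  segments.\<close>

definition splits :: "nat \<Rightarrow> nat \<Rightarrow> nat set \<Rightarrow> nat set set" where
  "splits p q B = {V. V \<subseteq> B \<and> p \<in> V \<and> q \<notin> V \<and> \<not> crossing V (B - V) \<and> \<not> crossing (B - V) V}"

text \<open>Up-sets of a finite linear order, here pulled back along \<open>f\<close>, form a chain,
  so their sizes tell them apart. Adding the \<open>f\<close>-largest missing element to an up-set
  of size \<open>m\<close> yields one of size \<open>Suc m\<close>.\<close>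

lemma upsets_card:
  fixes f :: "'a \<Rightarrow> 'b::linorder"
  assumes "finite B" "inj_on f B"
  shows "bij_betw card {V. V \<subseteq> B \<and> (\<forall>a\<in>V. \<forall>b\<in>B. f a \<le> f b \<longrightarrow> b \<in> V)} {0..card B}" (is "bij_betw _ ?U _")
proof (rule bij_betwI')
  fix V W assume VW: "V \<in> ?U" "W \<in> ?U"
  have "V \<subseteq> W \<or> W \<subseteq> V"
  proof (rule ccontr)
    assume "\<not> ?thesis"
    then obtain a b where "a \<in> V" "a \<notin> W" "b \<in> W" "b \<notin> V" by blast
    with VW show False using linear[of "f a" "f b"] by blast
  qed
  with VW show "card V = card W \<longleftrightarrow> V = W"
    using assms(1) card_subset_eq[of W V] card_subset_eq[of V W] finite_subset[of V B] finite_subset[of W B]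
    by auto
next
  fix V assume "V \<in> ?U" then show "card V \<in> {0..card B}" using assms(1) by (auto intro: card_mono)
next
  fix m assume "m \<in> {0..card B}"
  then have "m \<le> card B" by simp
  then show "\<exists>V\<in>?U. m = card V"
  proof (induction m)
    case 0
    then show ?case by (intro bexI[of _ "{}"]) auto
  next
    case (Suc m)
    then obtain V where V: "V \<in> ?U" "m = card V" by auto
    with Suc.prems have "B - V \<noteq> {}" by auto
    then obtain c where c: "c \<in> B - V" "\<And>b. b \<in> B - V \<Longrightarrow> f b \<le> f c"
      using assms(1) Max_in[of "f ` (B - V)"] Max_ge[of "f ` (B - V)"] by fastforce
    have "b \<in> insert c V" if "a \<in> insert c V" "b \<in> B" "f a \<le> f b" for a b
    proof (rule ccontr)
      assume b: "b \<notin> insert c V"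
      then have "f b \<le> f c" using c(2) that by auto
      moreover have "f b \<noteq> f c" using assms(2) b c(1) that(2) by (auto dest: inj_onD)
      ultimately show False using that V(1) b by auto
    qed
    then have "insert c V \<in> ?U" using V(1) c(1) by blast
    moreover have "finite V" using V(1) assms(1) by (auto intro: finite_subset)
    then have "Suc m = card (insert c V)" using c(1) V(2) by simp
    ultimately show ?case by blast
  qed
qed

text \<open>In the cyclic order from \<open>q\<close> to \<open>p\<close>, the splits are the
  up-sets other than the empty set and \<open>B\<close>, and there is one up-set of each
  size.\<close>

lemma splits_card:
  assumes "finite B" "adjacent_in B p q"
  shows "bij_betw card (splits p q B) {1..card B - 1}"
proof -
  have pq: "p \<in> B" "q \<in> B" "p < q" "\<And>a. a \<in> B \<Longrightarrow> a \<le> p \<or> q \<le> a"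
    using assms(2) by (auto simp: adjacent_in_def)
  \<comment> \<open>The elements up to \<open>p\<close> are lifted above \<open>Max B\<close>, so
    that \<open>q\<close> becomes the first and \<open>p\<close> the last element; the
    \<open>+ 1\<close> separates the image of 0 from \<open>Max B\<close>.\<close>
  define f where "f a = (if a \<le> p then a + Max B + 1 else a)" for a
  let ?U = "{V. V \<subseteq> B \<and> (\<forall>a\<in>V. \<forall>b\<in>B. f a \<le> f b \<longrightarrow> b \<in> V)}"
  have le: "a \<le> Max B" if "a \<in> B" for a using assms(1) that by simp
  have f: "f a \<le> f b \<longleftrightarrow> (q \<le> a \<and> b \<le> p) \<or> (a \<le> p \<and> b \<le> p \<and> a \<le> b) \<or> (q \<le> a \<and> q \<le> b \<and> a \<le> b)"
    if "a \<in> B" "b \<in> B" for a b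
    using le[OF that(1)] le[OF that(2)] pq(3) pq(4)[OF that(1)] pq(4)[OF that(2)]
    by (auto simp: f_def)
  have inj: "inj_on f B"
  proof (rule inj_onI)
    fix a b assume ab: "a \<in> B" "b \<in> B" "f a = f b"
    then have "f a \<le> f b" "f b \<le> f a" by simp_all
    then show "a = b" unfolding f[OF ab(1,2)] f[OF ab(2,1)] using pq(3) by linarith
  qed
  have "splits p q B = {V \<in> ?U. card V \<in> {1..card B - 1}}" (is "?L = ?R")
  proof (intro equalityI subsetI)
    fix V assume V: "V \<in> splits p q B"
    then have VB: "V \<subseteq> B" "p \<in> V" "q \<notin> V" "q \<in> B - V"
      and nc: "\<not> crossing V (B - V)" "\<not> crossing (B - V) V" using pq by (auto simp: splits_def)
    \<comment> \<open>If some \<open>a\<close> in \<open>V\<close> came before some \<open>b\<close>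
      outside \<open>V\<close>, then \<open>q\<close>, \<open>a\<close>, \<open>b\<close>,
      \<open>p\<close> would alternate between \<open>B - V\<close> and \<open>V\<close> around the
      cycle. Each linear order in which they can appear is a crossing.\<close>
    have "b \<in> V" if ab: "a \<in> V" "b \<in> B" "f a \<le> f b" for a b
    proof (rule ccontr)
      assume "b \<notin> V"
      with ab have b: "b \<in> B - V" by auto
      have ne: "a \<noteq> b" "b \<noteq> p" "a \<noteq> q" using ab VB b by auto
      have "f a \<le> f b \<longleftrightarrow> (q \<le> a \<and> b \<le> p) \<or> (a \<le> p \<and> b \<le> p \<and> a \<le> b) \<or> (q \<le> a \<and> q \<le> b \<and> a \<le> b)"
        using f ab VB by auto
      then consider "q < a \<and> b < p" | "b < p \<and> a < b" | "q < a \<and> a < b" using ne ab(3)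
        by linarith
      then show False
      proof cases
        case 1 then show ?thesis using crossingI[OF b VB(2) VB(4) ab(1)] nc pq by auto
      next
        case 2 then show ?thesis using crossingI[OF ab(1) b VB(2) VB(4)] nc pq by auto
      next
        case 3 then show ?thesis using crossingI[OF VB(2) VB(4) ab(1) b] nc pq by auto
      qed
    qed
    moreover have "card V \<in> {1..card B - 1}"
    proof -
      have "V \<subset> B" "finite V" "V \<noteq> {}" using VB assms(1) finite_subset[of V B] by auto
      then have "card V < card B" "0 < card V"
        using psubset_card_mono[OF assms(1)] by (auto simp: card_gt_0_iff)
      then show ?thesis by simp
    qed
    ultimately show "V \<in> ?R" using VB by blast
  next
    fix V assume V: "V \<in> ?R"
    then have VB: "V \<subseteq> B" and up: "\<And>a b. a \<in> V \<Longrightarrow> b \<in> B \<Longrightarrow> f a \<le> f b \<Longrightarrow> b \<in> V" by blast+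
    from V have "V \<noteq> {}" "V \<noteq> B" using pq assms(1) by auto
    then obtain a b where a: "a \<in> V" and b: "b \<in> B" "b \<notin> V" using VB by blast
    \<comment> \<open>In the order given by \<open>f\<close>, a nonempty up-set contains the last
      element \<open>p\<close>, and a proper one misses the first element \<open>q\<close>.\<close>
    have "p \<in> V" using up[OF a pq(1)] f[of a p] a VB pq by auto
    moreover have "q \<notin> V" using up[of q b] f[of q b] b pq by auto
    moreover have up': "a \<in> V \<Longrightarrow> b \<in> B \<Longrightarrow> (q \<le> a \<and> b \<le> p) \<or> (a \<le> p \<and> b \<le> p \<and> a \<le> b) \<or> (q \<le> a \<and> q \<le> b \<and> a \<le> b) \<Longrightarrow> b \<in> V" for a b
      using up f VB by blast
    moreover have "\<not> crossing V (B - V)"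
    proof
      assume "crossing V (B - V)"
      then obtain a b c d where *: "a \<in> V" "b \<in> B - V" "c \<in> V" "d \<in> B - V" "a < b" "b < c" "c < d"
        unfolding crossing_def by blast
      then show False using up'[of a b] up'[of c d] pq(4)[of a] pq(4)[of b] pq(4)[of c] pq(4)[of d] VB pq(3)
        by auto
    qed
    moreover have "\<not> crossing (B - V) V"
    proof
      assume "crossing (B - V) V"
      then obtain a b c d where *: "a \<in> B - V" "b \<in> V" "c \<in> B - V" "d \<in> V" "a < b" "b < c" "c < d"
        unfolding crossing_def by blast
      then show False using up'[of b c] up'[of d a] pq(4)[of a] pq(4)[of b] pq(4)[of c] pq(4)[of d] VB pq(3)
        by auto
    qed
    ultimately show "V \<in> splits p q B" using VB by (auto simp: splits_def)
  qed
  moreover have "bij_betw card {V \<in> ?U. card V \<in> {1..card B - 1}} {1..card B - 1}"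
    using upsets_card[OF assms(1) inj] unfolding bij_betw_def
    by (auto intro: inj_on_subset simp: image_iff) (smt (verit, best) atLeastAtMost_iff diff_le_self imageE le0 le_trans mem_Collect_eq)
  ultimately show ?thesis by simp
qed

section \<open>Alternating blocks\<close>

definition alternate :: "'a \<times> bool \<Rightarrow> nat \<Rightarrow> 'a \<times> bool" where
  "alternate x n = (if even n then x else letter_inv x)"

lemma alternate_add: "alternate (alternate x m) n = alternate x (m + n)"
  by (auto simp: alternate_def)

lemma alternate_cong: "even m \<longleftrightarrow> even n \<Longrightarrow> alternate x m = alternate x n"
  by (simp add: alternate_def)

lemma alternate_Suc: "alternate x (Suc n) = letter_inv (alternate x n)"
  by (simp add: alternate_def)

lemma alternate_inject: "alternate x n = alternate y n \<Longrightarrow> x = y"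
  by (metis alternate_def letter_inv_letter_inv)

text \<open>For \<open>a\<close> in \<open>V\<close> this is the position of \<open>a\<close> in the
  sorted set, counted from 0. For other \<open>a\<close> it is the shift in position that merging in
  \<open>V\<close> causes.\<close>

definition rank_in :: "nat set \<Rightarrow> nat \<Rightarrow> nat" where
  "rank_in V a = card (V \<inter> {..<a})"

text \<open>As \<open>letter_inv\<close> keeps the generator and flips the exponent, this single
  condition makes a block monochromatic and its exponents alternating.\<close>

definition alternates :: "(nat \<Rightarrow> 'a \<times> bool) \<Rightarrow> nat set \<Rightarrow> bool" where
  "alternates l V \<longleftrightarrow> finite V \<and> even (card V) \<and> (\<exists>x. \<forall>a\<in>V. l a = alternate x (rank_in V a))"

lemma rank_in_Un:
  assumes "finite V" "finite W" "V \<inter> W = {}"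
  shows "rank_in (V \<union> W) a = rank_in V a + rank_in W a"
  unfolding rank_in_def Int_Un_distrib2 using assms by (intro card_Un_disjoint) auto

lemma rank_in_adjacent:
  assumes "finite B" "adjacent_in B p q"
  shows "rank_in B q = Suc (rank_in B p)"
proof -
  have "B \<inter> {..<q} = insert p (B \<inter> {..<p})" using assms(2) by (force simp: adjacent_in_def)
  then show ?thesis using assms(1) by (simp add: rank_in_def)
qed

text \<open>Each gap between two points of \<open>V\<close> contains none or all of \<open>W\<close>.\<close>

lemma even_rank_in_iff:
  assumes W: "finite W" "even (card W)" "V \<inter> W = {}"
    and nc: "\<not> crossing V W" "\<not> crossing W V" and "a \<in> V" "b \<in> V"
  shows "even (rank_in W a) \<longleftrightarrow> even (rank_in W b)"
proof -
  have *: "even (rank_in W a) \<longleftrightarrow> even (rank_in W b)" if ab: "a \<in> V" "b \<in> V" "a < b" for a b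
  proof -
    have "W \<inter> {a<..<b} = {} \<or> W \<subseteq> {a<..<b}"
    proof (rule ccontr)
      assume "\<not> ?thesis"
      then obtain x y where x: "x \<in> W" "a < x" "x < b" and y: "y \<in> W" "y \<le> a \<or> b \<le> y"
        by (meson disjoint_iff greaterThanLessThan_iff not_less subsetI)
      then have "y < a \<or> b < y" using W(3) ab by (metis IntI emptyE nat_less_le)
      then show False
        using crossingI[of a V x W b y] crossingI[of y W a V x b] nc ab x y by blast
    qed
    then have "even (card (W \<inter> {a<..<b}))" using W(2) by (auto simp: Int_absorb2)
    moreover have "rank_in W b = rank_in W a + card (W \<inter> {a<..<b})"
    proof -
      have "W \<inter> {..<b} = (W \<inter> {..<a}) \<union> (W \<inter> {a<..<b})"
        using ab W(3) by (auto simp: not_less)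
      moreover have "card ((W \<inter> {..<a}) \<union> (W \<inter> {a<..<b})) = card (W \<inter> {..<a}) + card (W \<inter> {a<..<b})"
        using W(1) by (intro card_Un_disjoint) auto
      ultimately show ?thesis unfolding rank_in_def by (rule trans[OF arg_cong])
    qed
    ultimately show ?thesis by simp
  qed
  consider "a < b" | "a = b" | "b < a" by linarith
  then show ?thesis
    by cases (use *[OF assms(6,7)] *[OF assms(7,6)] in blast)+
qed

text \<open>Removing \<open>W\<close> shifts the ranks of all points of \<open>V\<close> by numbers
  of the same parity, so \<open>V\<close> still alternates, possibly with the inverse starting
  letter.\<close>

lemma alternates_split:
  assumes "V \<inter> W = {}" "\<not> crossing V W" "\<not> crossing W V" "alternates l (V \<union> W)" "even (card V)"
  shows "alternates l V"
proof (cases "V = {}")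
  case False
  then obtain a0 where a0: "a0 \<in> V" by blast
  from assms(4) obtain x where fin: "finite V" "finite W" and even: "even (card (V \<union> W))"
    and x: "\<And>a. a \<in> V \<union> W \<Longrightarrow> l a = alternate x (rank_in (V \<union> W) a)"
    by (auto simp: alternates_def)
  have "even (card W)" using even assms(1,5) fin by (simp add: card_Un_disjoint)
  note parity = even_rank_in_iff[OF fin(2) this assms(1-3)]
  have "l a = alternate (alternate x (rank_in W a0)) (rank_in V a)" if "a \<in> V" for a
    using x[of a] that parity[OF a0 that] unfolding rank_in_Un[OF fin assms(1)] alternate_add
    by (auto intro: alternate_cong)
  then show ?thesis using fin assms(5) unfolding alternates_def by blast
qed (simp add: alternates_def)

text \<open>Merging shifts the ranks within each part by a constant parity, so each part follows an
  alternating pattern in the merged ranks. The ranks of \<open>p\<close> and \<open>q\<close> in the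
  union differ by one and their letters are inverse, which forces the two patterns to agree.\<close>

lemma alternates_join:
  assumes "V \<inter> W = {}" "\<not> crossing V W" "\<not> crossing W V" "alternates l V" "alternates l W"
    and "p \<in> V" "q \<in> W" "adjacent_in (V \<union> W) p q" "l q = letter_inv (l p)"
  shows "alternates l (V \<union> W)"
proof -
  from assms(4,5) obtain x y where fin: "finite V" "finite W" and even: "even (card V)" "even (card W)"
    and x: "\<And>a. a \<in> V \<Longrightarrow> l a = alternate x (rank_in V a)"
    and y: "\<And>a. a \<in> W \<Longrightarrow> l a = alternate y (rank_in W a)"
    by (auto simp: alternates_def)
  have [simp]: "W \<inter> V = {}" using assms(1) by blast
  \<comment> \<open>The starting letters relative to ranks in the union; the parity of the shift may
    be read off at any point of the part, here at \<open>p\<close> and \<open>q\<close>.\<close>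
  define x' y' where "x' = alternate x (rank_in W p)" and "y' = alternate y (rank_in V q)"
  have x': "l a = alternate x' (rank_in (V \<union> W) a)" if "a \<in> V" for a
    using x[OF that] even_rank_in_iff[OF fin(2) even(2) assms(1-3,6) that]
    unfolding x'_def rank_in_Un[OF fin assms(1)] alternate_add by (auto intro: alternate_cong)
  have y': "l a = alternate y' (rank_in (V \<union> W) a)" if "a \<in> W" for a
    using y[OF that] even_rank_in_iff[OF fin(1) even(1) _ assms(3,2,7) that]
    unfolding y'_def rank_in_Un[OF fin assms(1)] alternate_add by (auto intro: alternate_cong)
  have "rank_in (V \<union> W) q = Suc (rank_in (V \<union> W) p)"
    using rank_in_adjacent[OF _ assms(8)] fin by simp
  then have "alternate x' (rank_in (V \<union> W) q) = alternate y' (rank_in (V \<union> W) q)"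
    using x'[OF assms(6)] y'[OF assms(7)] assms(9) by (simp add: alternate_Suc)
  then have "x' = y'" by (rule alternate_inject)
  then show ?thesis
    using fin even x' y' assms(1) unfolding alternates_def
    by (intro conjI exI[of _ x']) (auto simp: card_Un_disjoint)
qed

lemma alternates_pair:
  assumes "p < q" "l q = letter_inv (l p)"
  shows "alternates l {p, q}"
proof -
  have "rank_in {p, q} p = 0" "rank_in {p, q} q = 1"
    using assms(1) by (auto simp: rank_in_def Int_insert_left)
  then show ?thesis
    using assms by (auto simp: alternates_def alternate_def intro!: exI[of _ "l p"])
qed

lemma alternates_adjacent:
  assumes "alternates l V" "adjacent_in V p q"
  shows "l q = letter_inv (l p)"
proof -
  from assms(1) obtain x where "finite V" "\<And>a. a \<in> V \<Longrightarrow> l a = alternate x (rank_in V a)"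
    by (auto simp: alternates_def)
  then show ?thesis
    using assms(2) rank_in_adjacent[of V p q] by (simp add: alternate_Suc adjacent_in_def)
qed

section \<open>Sums over alternating non-crossing partitions\<close>

text \<open>The positions form an arbitrary set \<open>A\<close>, so that a cancelled pair of
  letters can be deleted without renumbering the others.\<close>

definition alt_nc_partitions :: "(nat \<Rightarrow> 'a \<times> bool) \<Rightarrow> nat set \<Rightarrow> nat set set set" where
  "alt_nc_partitions l A = {P. partition_on A P \<and>
     (\<forall>V\<in>P. \<forall>W\<in>P. V \<noteq> W \<longrightarrow> \<not> crossing V W) \<and> (\<forall>V\<in>P. alternates l V)}"

lemma alt_nc_partitionsD:
  assumes "P \<in> alt_nc_partitions l A"
  shows "partition_on A P" "V \<in> P \<Longrightarrow> W \<in> P \<Longrightarrow> V \<noteq> W \<Longrightarrow> \<not> crossing V W"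
    "V \<in> P \<Longrightarrow> alternates l V" "V \<in> P \<Longrightarrow> V \<subseteq> A" "V \<in> P \<Longrightarrow> V \<noteq> {}"
    "V \<in> P \<Longrightarrow> W \<in> P \<Longrightarrow> V \<noteq> W \<Longrightarrow> V \<inter> W = {}" "V \<in> P \<Longrightarrow> W \<in> P \<Longrightarrow> a \<in> V \<Longrightarrow> a \<in> W \<Longrightarrow> V = W"
    "a \<in> A \<Longrightarrow> \<exists>V\<in>P. a \<in> V"
  using assms unfolding alt_nc_partitions_def partition_on_def disjoint_def by auto

lemma finite_alt_nc_partitions: "finite A \<Longrightarrow> finite (alt_nc_partitions l A)"
  by (rule finite_subset[OF _ finitely_many_partition_on]) (auto simp: alt_nc_partitions_def)

text \<open>Take two points \<open>p < q\<close> of one block at least distance. A point of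
  \<open>A\<close> between them would lie in another block, by minimality. That block has even size,
  hence a second point: between \<open>p\<close> and \<open>q\<close> it gives a closer pair,
  outside it gives a crossing. So \<open>p\<close> and \<open>q\<close> are neighbours in
  \<open>A\<close> and in their block.\<close>

lemma ex_adjacent_inverse:
  assumes P: "P \<in> alt_nc_partitions l A" and "A \<noteq> {}"
  shows "\<exists>p q. adjacent_in A p q \<and> l q = letter_inv (l p)"
proof -
  note PD = alt_nc_partitionsD[OF P]
  have two: "\<exists>b\<in>V. b \<noteq> a" if "V \<in> P" "a \<in> V" for V a
  proof (rule ccontr)
    assume "\<not> ?thesis"
    then have "V = {a}" using that by blast
    then show False using PD(3)[OF that(1)] by (auto simp: alternates_def)
  qed
  let ?S = "\<lambda>(a, b). a < b \<and> (\<exists>V\<in>P. a \<in> V \<and> b \<in> V)"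
  obtain a V where "a \<in> A" "V \<in> P" "a \<in> V" using PD(8) assms(2) by blast
  then obtain b where "b \<in> V" "b \<noteq> a" using two by blast
  then have "?S (min a b, max a b)" using \<open>V \<in> P\<close> \<open>a \<in> V\<close> by (auto simp: min_def max_def)
  then obtain y where S: "?S y" and min: "\<forall>z. ?S z \<longrightarrow> snd y - fst y \<le> snd z - fst z"
    using ex_has_least_nat[of ?S "(min a b, max a b)" "\<lambda>z. snd z - fst z"] by blast
  obtain p q where y: "y = (p, q)" by (cases y)
  obtain V where pq: "p < q" "V \<in> P" "p \<in> V" "q \<in> V" using S y by auto
  have min': False if "a < b" "W \<in> P" "a \<in> W" "b \<in> W" "b - a < q - p" for a b W
    using min[THEN spec, of "(a, b)"] that y by auto
  have adj: "adjacent_in A p q"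
    unfolding adjacent_in_def
  proof (intro conjI ballI)
    show "p \<in> A" "q \<in> A" "p < q" using PD(4) pq by auto
    fix c assume "c \<in> A"
    show "c \<le> p \<or> q \<le> c"
    proof (rule ccontr)
      assume "\<not> ?thesis"
      then have c: "p < c" "c < q" by auto
      obtain W where W: "W \<in> P" "c \<in> W" using PD(8) \<open>c \<in> A\<close> by blast
      have ne: "W \<noteq> V" using min'[of p c V] pq W c diff_less_mono[of c q p] by auto
      then have disj: "V \<inter> W = {}" using PD(6) W pq by auto
      obtain c' where c': "c' \<in> W" "c' \<noteq> c" using two[OF W] by blast
      have "c' \<noteq> p" "c' \<noteq> q" using disj pq c' by auto
      then consider "c' < p" | "q < c'" | "p < c'" "c' < q" by linarith
      then show False
      proof cases
        case 1
        then show ?thesis using crossingI[of c' W p V c q] PD(2)[of W V] W c' pq c ne by auto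
      next
        case 2
        then show ?thesis using crossingI[of p V c W q c'] PD(2)[of V W] W c' pq c ne by auto
      next
        case 3
        then have "c < c' \<and> c' - c < q - p \<or> c' < c \<and> c - c' < q - p" using c c'(2) by arith
        then show ?thesis using min' W c'(1) by blast
      qed
    qed
  qed
  moreover have "adjacent_in V p q" using adj pq PD(4) unfolding adjacent_in_def by blast
  then have "l q = letter_inv (l p)" using alternates_adjacent PD(3) pq(2) by blast
  ultimately show ?thesis by blast
qed

definition partition_weight :: "nat set set \<Rightarrow> real" where
  "partition_weight P = (\<Prod>V\<in>P. signed_catalan (card V div 2))"

text \<open>Nothing of \<open>A\<close> lies between \<open>p\<close> and \<open>q\<close>, so the
  block \<open>{p, q}\<close> crosses no other block and can be added or removed freely; its weight
  \<open>signed_catalan 1\<close> is 1.\<close>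

lemma sum_partitions_with_pair:
  assumes A: "finite A" and adj: "adjacent_in A p q" and l: "l q = letter_inv (l p)"
  shows "(\<Sum>P | P \<in> alt_nc_partitions l A \<and> {p, q} \<in> P. partition_weight P)
    = (\<Sum>P\<in>alt_nc_partitions l (A - {p, q}). partition_weight P)"
proof (rule sum.reindex_bij_witness[of _ "insert {p, q}" "\<lambda>P. P - {{p, q}}"], goal_cases)
  case (1 P)
  then show ?case by auto
next
  case (2 P)
  then have P: "P \<in> alt_nc_partitions l A" and pq: "{p, q} \<in> P" by auto
  note PD = alt_nc_partitionsD[OF P]
  have "\<Union> (P - {{p, q}}) = A - {p, q}"
  proof (intro equalityI subsetI)
    fix a assume "a \<in> \<Union> (P - {{p, q}})"
    then obtain V where "V \<in> P" "V \<noteq> {p, q}" "a \<in> V" by blast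
    then show "a \<in> A - {p, q}" using PD(4)[of V] PD(6)[of V "{p, q}"] pq by blast
  next
    fix a assume "a \<in> A - {p, q}"
    then obtain V where "V \<in> P" "a \<in> V" "a \<notin> {p, q}" using PD(8)[of a] by blast
    then show "a \<in> \<Union> (P - {{p, q}})" by blast
  qed
  then have "partition_on (A - {p, q}) (P - {{p, q}})"
    using PD(1) by (auto simp: partition_on_def disjoint_def)
  then show ?case using PD(2,3) by (simp add: alt_nc_partitions_def)
next
  case (3 P)
  then have "{p, q} \<notin> P" using alt_nc_partitionsD(4)[of P l "A - {p, q}" "{p, q}"] by blast
  then show ?case by auto
next
  case (4 P)
  note PD = alt_nc_partitionsD[OF 4]
  have "\<Union> (insert {p, q} P) = A"
    using PD(1) adj by (auto simp: partition_on_def adjacent_in_def)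
  moreover have "disjoint (insert {p, q} P)"
    using PD(1) unfolding partition_on_def disjoint_def by auto
  ultimately have "partition_on A (insert {p, q} P)"
    using PD(1) by (auto simp: partition_on_def)
  moreover have "\<not> crossing {p, q} V \<and> \<not> crossing V {p, q}" if "V \<in> P" for V
    using PD(4)[OF that] adj unfolding crossing_def adjacent_in_def by fastforce
  moreover have "alternates l {p, q}"
    using alternates_pair[of p q l] adj l by (simp add: adjacent_in_def)
  ultimately show ?case using PD(2,3) by (auto simp: alt_nc_partitions_def)
next
  case (5 P)
  then have P: "partition_on A P" "{p, q} \<in> P" by (auto simp: alt_nc_partitions_def)
  then have "finite P" using A finite_elements by blast
  moreover have "card {p, q} = 2" using adj by (simp add: adjacent_in_def)
  ultimately show ?case
    using P(2) by (simp add: partition_weight_def prod.remove[of P "{p, q}"] signed_catalan_def catalan_def)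
qed

section \<open>Cutting and joining the blocks of two neighbours\<close>

definition split_block :: "nat set set \<Rightarrow> nat set \<Rightarrow> nat set \<Rightarrow> nat set set" where
  "split_block Q B V = insert V (insert (B - V) (Q - {B}))"

definition block_of :: "'a set set \<Rightarrow> 'a \<Rightarrow> 'a set" where
  "block_of P a = (THE V. V \<in> P \<and> a \<in> V)"

lemma block_of_eqI: "partition_on A P \<Longrightarrow> V \<in> P \<Longrightarrow> a \<in> V \<Longrightarrow> block_of P a = V"
  unfolding block_of_def partition_on_def disjoint_def by (rule the_equality) auto

lemma block_of: "partition_on A P \<Longrightarrow> a \<in> A \<Longrightarrow> block_of P a \<in> P \<and> a \<in> block_of P a"
  using block_of_eqI[of A P] by (auto simp: partition_on_def)

text \<open>Parts of \<open>B\<close> cross no other block because \<open>B\<close> does not, and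
  \<open>splits\<close> excludes crossings of the two parts with each other. Since \<open>B\<close>
  has even size, an even \<open>V\<close> leaves an even rest, so both parts still
  alternate.\<close>

lemma split_block_mem:
  assumes Q: "Q \<in> alt_nc_partitions l A" and B: "B \<in> Q" "q \<in> B"
    and V: "V \<in> splits p q B" "even (card V)"
  shows "split_block Q B V \<in> alt_nc_partitions l A"
proof -
  note QD = alt_nc_partitionsD[OF Q]
  from V have VB: "V \<subseteq> B" "V \<noteq> {}" "q \<notin> V" "\<not> crossing V (B - V)" "\<not> crossing (B - V) V"
    by (auto simp: splits_def)
  have disj: "X \<inter> B = {}" "\<not> crossing X B" "\<not> crossing B X" if "X \<in> Q - {B}" for X
    using that QD(2,6) B by auto
  have "\<Union> (split_block Q B V) = \<Union> (insert B (Q - {B}))"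
    using VB(1) unfolding split_block_def by blast
  also have "\<dots> = A" using B QD(1) by (simp add: insert_absorb partition_on_def)
  finally have "\<Union> (split_block Q B V) = A" .
  moreover have "disjoint (split_block Q B V)"
  proof -
    have "X \<inter> V = {}" "X \<inter> (B - V) = {}" if "X \<in> Q - {B}" for X
      using disj(1)[OF that] VB(1) by blast+
    moreover have "disjoint (Q - {B})" using QD(6) by (auto simp: disjoint_def)
    ultimately show ?thesis unfolding split_block_def by (auto simp: disjoint_def)
  qed
  moreover have "{} \<notin> split_block Q B V" using VB B QD(5) by (auto simp: split_block_def)
  ultimately have "partition_on A (split_block Q B V)" by (auto simp: partition_on_def)
  moreover have "\<not> crossing X Y" if "X \<in> split_block Q B V" "Y \<in> split_block Q B V" "X \<noteq> Y" for X Y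
  proof -
    have "\<not> crossing X V" "\<not> crossing X (B - V)" "\<not> crossing V X" "\<not> crossing (B - V) X"
      if "X \<in> Q - {B}" for X
      using disj(2,3)[OF that] VB(1) crossing_mono by (metis Diff_subset order_refl)+
    then show ?thesis using that VB(4,5) QD(2) unfolding split_block_def by blast
  qed
  moreover have "alternates l X" if "X \<in> split_block Q B V" for X
  proof -
    have alt: "alternates l B" using QD(3) B by blast
    then have "finite B" "even (card B)" by (auto simp: alternates_def)
    then have "even (card (B - V))" using V(2) VB(1) by (simp add: card_Diff_subset finite_subset card_mono)
    then have "alternates l V" "alternates l (B - V)"
      using alternates_split[of V "B - V" l] alternates_split[of "B - V" V l] VB V(2) alt
      by (auto simp: Un_absorb1 Un_absorb2)
    then show ?thesis using that QD(3) by (auto simp: split_block_def)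
  qed
  ultimately show ?thesis by (simp add: alt_nc_partitions_def)
qed

lemma join_blocks_mem:
  assumes P: "P \<in> alt_nc_partitions l A" and adj: "adjacent_in A p q" and l: "l q = letter_inv (l p)"
    and VW: "V \<in> P" "W \<in> P" "V \<noteq> W" "p \<in> V" "q \<in> W"
  shows "insert (V \<union> W) (P - {V, W}) \<in> alt_nc_partitions l A"
proof -
  note PD = alt_nc_partitionsD[OF P]
  have disj: "X \<inter> (V \<union> W) = {}" if "X \<in> P - {V, W}" for X
    using that PD(6)[of X V] PD(6)[of X W] VW by auto
  have "\<Union> (insert (V \<union> W) (P - {V, W})) = \<Union> P" using VW by blast
  also have "\<dots> = A" using PD(1) by (simp add: partition_on_def)
  finally have "\<Union> (insert (V \<union> W) (P - {V, W})) = A" .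
  moreover have "disjoint (insert (V \<union> W) (P - {V, W}))"
    using disj PD(6) unfolding disjoint_def by (auto simp: Int_commute)
  moreover have "{} \<notin> insert (V \<union> W) (P - {V, W})" using PD(5) VW by auto
  ultimately have "partition_on A (insert (V \<union> W) (P - {V, W}))" by (auto simp: partition_on_def)
  moreover have "\<not> crossing (V \<union> W) X \<and> \<not> crossing X (V \<union> W)" if X: "X \<in> P - {V, W}" for X
    using not_crossing_Un[OF adj PD(4)[OF VW(1)] PD(4)[OF VW(2)] _ VW(4,5) disj[OF X]]
      X PD(2) PD(4)[of X] VW by auto
  moreover have "alternates l (V \<union> W)"
  proof (rule alternates_join[OF _ _ _ _ _ VW(4,5) _ l])
    show "adjacent_in (V \<union> W) p q"
      using adj VW PD(4)[OF VW(1)] PD(4)[OF VW(2)] unfolding adjacent_in_def by blast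
  qed (use VW PD in auto)
  ultimately show ?thesis using PD(2,3) by (auto simp: alt_nc_partitions_def)
qed

text \<open>Each size \<open>2 * j\<close> with \<open>0 < j < card B div 2\<close> belongs to
  exactly one split, so halving the size turns the sum into the Catalan convolution.\<close>

lemma sum_even_splits:
  assumes "finite B" "even (card B)" "card B > 2" "adjacent_in B p q"
  shows "(\<Sum>V | V \<in> splits p q B \<and> even (card V).
      signed_catalan (card V div 2) * signed_catalan (card (B - V) div 2)) = - signed_catalan (card B div 2)"
proof -
  let ?n = "card B div 2"
  have "bij_betw card {V. V \<in> splits p q B \<and> even (card V)} {m \<in> {1..card B - 1}. even m}"
    using splits_card[OF assms(1,4)] unfolding bij_betw_def by (auto intro: inj_on_subset)
  moreover have "bij_betw (\<lambda>m. m div 2) {m \<in> {1..card B - 1}. even m} {1..?n - 1}"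
    by (rule bij_betw_byWitness[of _ "\<lambda>j. 2 * j"]) (use assms(2,3) in \<open>auto elim!: evenE\<close>)
  ultimately have bij: "bij_betw (\<lambda>V. card V div 2) {V. V \<in> splits p q B \<and> even (card V)} {1..?n - 1}"
    using bij_betw_trans by (fastforce simp: comp_def)
  have "card (B - V) div 2 = ?n - card V div 2" if "V \<in> splits p q B" "even (card V)" for V
  proof -
    have "V \<subseteq> B" using that by (simp add: splits_def)
    then have "card (B - V) = card B - card V" using assms(1) by (simp add: card_Diff_subset finite_subset)
    then show ?thesis using that(2) assms(2) by (auto elim!: evenE)
  qed
  then have "(\<Sum>V | V \<in> splits p q B \<and> even (card V).
      signed_catalan (card V div 2) * signed_catalan (card (B - V) div 2))
    = (\<Sum>V | V \<in> splits p q B \<and> even (card V).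
      signed_catalan (card V div 2) * signed_catalan (?n - card V div 2))"
    by (intro sum.cong) auto
  also have "\<dots> = (\<Sum>j=1..?n-1. signed_catalan j * signed_catalan (?n - j))"
    using sum.reindex_bij_betw[OF bij, of "\<lambda>j. signed_catalan j * signed_catalan (?n - j)"] by simp
  also have "\<dots> = - signed_catalan ?n"
    using assms(2,3) by (intro signed_catalan_convolution) (auto elim!: evenE)
  finally show ?thesis .
qed

text \<open>The two parts are nonempty, distinct and not among the other blocks, so exactly two new
  factors replace that of \<open>B\<close>.\<close>

lemma partition_weight_split_block:
  assumes "finite A" "partition_on A Q" "B \<in> Q" "V \<in> splits p q B" "q \<in> B"
  shows "partition_weight (split_block Q B V)
    = (\<Prod>X\<in>Q - {B}. signed_catalan (card X div 2)) *
      (signed_catalan (card V div 2) * signed_catalan (card (B - V) div 2))"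
proof -
  have V: "V \<subseteq> B" "V \<noteq> {}" "B - V \<noteq> {}" "V \<noteq> B - V" using assms(4,5) by (auto simp: splits_def)
  have "X \<inter> B = {}" if "X \<in> Q - {B}" for X
    using assms(2,3) that by (auto simp: partition_on_def disjoint_def)
  then have "V \<notin> Q - {B}" "B - V \<notin> Q - {B}" using V by blast+
  moreover have "finite Q" using assms(1,2) finite_elements by blast
  ultimately show ?thesis
    using V(4) unfolding partition_weight_def split_block_def by simp
qed

text \<open>Joining the blocks of \<open>p\<close> and \<open>q\<close> groups the partitions that separate \<open>p\<close> and \<open>q\<close>; by the
  Catalan recurrence each group cancels against the joined partition.\<close>

lemma sum_partitions_without_pair:
  assumes A: "finite A" and adj: "adjacent_in A p q" and l: "l q = letter_inv (l p)"
  shows "(\<Sum>P | P \<in> alt_nc_partitions l A \<and> {p, q} \<notin> P. partition_weight P) = 0"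
proof -
  let ?ALL = "alt_nc_partitions l A"
  let ?split = "\<lambda>(Q, V). split_block Q (block_of Q p) V"
  let ?join = "\<lambda>P. (insert (block_of P p \<union> block_of P q) (P - {block_of P p, block_of P q}), block_of P p)"
  \<comment> \<open>\<open>N\<close> collects the partitions that separate \<open>p\<close> and
    \<open>q\<close>, \<open>J\<close> those in which they share a block with further points. In
    \<open>S\<close>, only even cuts are kept, since alternating blocks have even size.\<close>
  define N where "N = {P \<in> ?ALL. q \<notin> block_of P p}"
  define J where "J = {P \<in> ?ALL. q \<in> block_of P p \<and> block_of P p \<noteq> {p, q}}"
  define S where "S Q = {V. V \<in> splits p q (block_of Q p) \<and> even (card V)}" for Q
  have pqA: "p \<in> A" "q \<in> A" "p < q" using adj by (auto simp: adjacent_in_def)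
  have fin: "finite ?ALL" using A by (rule finite_alt_nc_partitions)
  have part: "partition_on A P" if "P \<in> ?ALL" for P using that alt_nc_partitionsD(1) by blast
  have J: "block_of Q p \<in> Q" "p \<in> block_of Q p" "q \<in> block_of Q p" "block_of Q p \<subseteq> A"
    "finite (block_of Q p)" "adjacent_in (block_of Q p) p q" if "Q \<in> J" for Q
  proof -
    show *: "block_of Q p \<in> Q" "p \<in> block_of Q p" "q \<in> block_of Q p"
      using that block_of[OF part pqA(1)] by (auto simp: J_def)
    show "block_of Q p \<subseteq> A" using that *(1) alt_nc_partitionsD(4)[of Q l A] by (auto simp: J_def)
    then show "finite (block_of Q p)" "adjacent_in (block_of Q p) p q"
      using A adj * finite_subset unfolding adjacent_in_def by blast+
  qed
  have pair: "{p, q} \<in> P \<longleftrightarrow> block_of P p = {p, q}" if "P \<in> ?ALL" for P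
    using block_of_eqI[OF part[OF that], of "{p, q}" p] block_of[OF part[OF that] pqA(1)] by auto
  have "{P. P \<in> ?ALL \<and> {p, q} \<notin> P} = N \<union> J"
    using pair by (auto simp: N_def J_def)
  then have "(\<Sum>P | P \<in> ?ALL \<and> {p, q} \<notin> P. partition_weight P)
      = (\<Sum>P\<in>N. partition_weight P) + (\<Sum>P\<in>J. partition_weight P)"
    using fin by (simp only:) (rule sum.union_disjoint; auto simp: N_def J_def)
  also have "(\<Sum>P\<in>N. partition_weight P)
      = (\<Sum>(Q, V)\<in>Sigma J S. partition_weight (split_block Q (block_of Q p) V))"
  proof (rule sum.reindex_bij_witness[of _ ?split ?join])
    fix P assume "P \<in> N"
    then have P: "P \<in> ?ALL" and sep: "q \<notin> block_of P p" by (auto simp: N_def)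
    note PD = alt_nc_partitionsD[OF P]
    define V W where "V = block_of P p" and "W = block_of P q"
    have VW: "V \<in> P" "W \<in> P" "V \<noteq> W" "p \<in> V" "q \<in> W"
      using block_of[OF part[OF P]] pqA sep by (auto simp: V_def W_def)
    define Q where "Q = insert (V \<union> W) (P - {V, W})"
    have Q: "Q \<in> ?ALL" unfolding Q_def by (rule join_blocks_mem[OF P adj l VW])
    then have blk: "block_of Q p = V \<union> W"
      using block_of_eqI[OF part, of Q "V \<union> W" p] VW by (auto simp: Q_def)
    have disj: "V \<inter> W = {}" using PD(6) VW by blast
    have even: "even (card V)" "even (card W)" "finite V" "finite W"
      using PD(3) VW by (auto simp: alternates_def)
    have diff: "V \<union> W - V = W" using disj by blast
    \<comment> \<open>Ensures that joining leads into \<open>J\<close>: otherwise \<open>V\<close>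
      would be a singleton, of odd size.\<close>
    have "V \<union> W \<noteq> {p, q}"
    proof
      assume "V \<union> W = {p, q}"
      then have "V = {p}" using VW disj by blast
      then show False using even by simp
    qed
    then have QJ: "Q \<in> J" using Q blk VW by (simp add: J_def)
    have VS: "V \<in> S Q"
      using VW disj diff PD(2) even blk by (auto simp: S_def splits_def)
    \<comment> \<open>The joined block is not among the remaining ones, so removing it from
      \<open>Q\<close> and putting back \<open>V\<close> and \<open>W\<close> recovers
      \<open>P\<close>.\<close>
    have "X \<noteq> V \<union> W" if "X \<in> P - {V, W}" for X
      using that PD(7)[of X V p] VW by blast
    then have "Q - {V \<union> W} = P - {V, W}" unfolding Q_def by blast
    then have "split_block Q (V \<union> W) V = P" using VW diff unfolding split_block_def by auto
    then show "?split (?join P) = P"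
      using blk unfolding Q_def V_def W_def by simp
    show "?join P \<in> Sigma J S"
      using QJ VS unfolding Q_def V_def W_def by simp
    show "(case ?join P of (Q, V) \<Rightarrow> partition_weight (split_block Q (block_of Q p) V)) = partition_weight P"
      using blk \<open>split_block Q (V \<union> W) V = P\<close> unfolding Q_def V_def W_def by simp
  next
    fix QV assume "QV \<in> Sigma J S"
    then obtain Q V where QV: "QV = (Q, V)" "Q \<in> J" "V \<in> S Q" by auto
    define B where "B = block_of Q p"
    note B = J[OF QV(2), folded B_def]
    have Q: "Q \<in> ?ALL" using QV by (simp add: J_def)
    have V: "V \<in> splits p q B" "even (card V)" using QV by (auto simp: S_def B_def)
    then have VB: "V \<subseteq> B" "p \<in> V" "q \<notin> V" by (auto simp: splits_def)
    have P: "split_block Q B V \<in> ?ALL" by (rule split_block_mem[OF Q B(1,3) V])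
    have "block_of (split_block Q B V) p = V" "block_of (split_block Q B V) q = B - V"
      using block_of_eqI[OF part[OF P]] VB B(3) by (auto simp: split_block_def)
    moreover have "V \<notin> Q - {B}" "B - V \<notin> Q - {B}"
      using alt_nc_partitionsD(7)[OF Q] B VB by blast+
    then have "split_block Q B V - {V, B - V} = Q - {B}" unfolding split_block_def by blast
    moreover have "V \<union> (B - V) = B" using VB by blast
    ultimately show "?join (?split QV) = QV"
      using QV(1) B(1) unfolding B_def by (simp add: insert_absorb)
    show "?split QV \<in> N"
      using P VB \<open>block_of (split_block Q B V) p = V\<close> QV(1) unfolding B_def by (simp add: N_def)
  qed
  also have "\<dots> = (\<Sum>Q\<in>J. \<Sum>V\<in>S Q. partition_weight (split_block Q (block_of Q p) V))"
  proof (rule sum.Sigma[symmetric])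
    show "finite J" using fin by (simp add: J_def)
    show "\<forall>Q\<in>J. finite (S Q)"
      using J(5) by (auto simp: S_def splits_def intro: finite_subset[of _ "Pow (block_of _ p)"])
  qed
  also have "\<dots> = (\<Sum>Q\<in>J. - partition_weight Q)"
  proof (rule sum.cong)
    fix Q assume Q: "Q \<in> J"
    define B where "B = block_of Q p"
    note B = J[OF Q, folded B_def]
    have Q': "Q \<in> ?ALL" "B \<noteq> {p, q}" using Q by (auto simp: J_def B_def)
    \<comment> \<open>A block in \<open>J\<close> has a point besides \<open>p\<close> and
      \<open>q\<close>, so its half size is at least 2, where the Catalan recurrence holds.\<close>
    have "card {p, q} < card B" using B Q'(2) by (intro psubset_card_mono) auto
    then have "card B > 2" using pqA by simp
    have "even (card B)" using alt_nc_partitionsD(3)[OF Q'(1) B(1)] by (simp add: alternates_def)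
    have "(\<Sum>V\<in>S Q. partition_weight (split_block Q B V)) =
        (\<Prod>X\<in>Q - {B}. signed_catalan (card X div 2)) *
        (\<Sum>V\<in>S Q. signed_catalan (card V div 2) * signed_catalan (card (B - V) div 2))"
      unfolding sum_distrib_left
      by (rule sum.cong) (auto simp: S_def B_def[symmetric] intro!: partition_weight_split_block[OF A part[OF Q'(1)] B(1) _ B(3)])
    also have "(\<Sum>V\<in>S Q. signed_catalan (card V div 2) * signed_catalan (card (B - V) div 2))
        = - signed_catalan (card B div 2)"
      using sum_even_splits[OF B(5) \<open>even (card B)\<close> \<open>card B > 2\<close> B(6)] by (simp add: S_def B_def)
    also have "(\<Prod>X\<in>Q - {B}. signed_catalan (card X div 2)) * - signed_catalan (card B div 2) = - partition_weight Q"
      using prod.remove[of Q B "\<lambda>X. signed_catalan (card X div 2)"] B(1) finite_elements[OF A part[OF Q'(1)]]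
      by (simp add: partition_weight_def mult.commute)
    finally show "(\<Sum>V\<in>S Q. partition_weight (split_block Q (block_of Q p) V)) = - partition_weight Q"
      by (simp add: B_def)
  qed simp
  finally show ?thesis by (simp add: sum_negf)
qed

lemma sum_alt_nc_partitions_cancel:
  assumes "finite A" "adjacent_in A p q" "l q = letter_inv (l p)"
  shows "(\<Sum>P\<in>alt_nc_partitions l A. partition_weight P)
    = (\<Sum>P\<in>alt_nc_partitions l (A - {p, q}). partition_weight P)"
proof -
  have "(\<Sum>P\<in>alt_nc_partitions l A. partition_weight P) =
      (\<Sum>P | P \<in> alt_nc_partitions l A \<and> {p, q} \<in> P. partition_weight P) +
      (\<Sum>P | P \<in> alt_nc_partitions l A \<and> {p, q} \<notin> P. partition_weight P)"
    using sum.Int_Diff[OF finite_alt_nc_partitions[OF assms(1)], of partition_weight l "{P. {p, q} \<in> P}"]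
    by (simp add: Int_def set_diff_eq)
  then show ?thesis
    by (simp only: sum_partitions_with_pair[OF assms] sum_partitions_without_pair[OF assms])
qed

section \<open>Reduction of words\<close>

lemma sorted_list_of_set_idem: "sorted_wrt (<) xs \<Longrightarrow> sorted_list_of_set (set xs) = (xs :: nat list)"
  by (rule sorted_list_of_set.idem_if_sorted_distinct) (auto simp: strict_sorted_iff)

lemma sorted_list_of_set_adjacent:
  assumes "finite A" "sorted_list_of_set A = xs @ p # q # ys"
  shows "adjacent_in A p q" "sorted_list_of_set (A - {p, q}) = xs @ ys"
proof -
  have s: "sorted_wrt (<) (xs @ p # q # ys)" and A: "A = set (xs @ p # q # ys)"
    using assms strict_sorted_list_of_set[of A] set_sorted_list_of_set[of A] by simp_all
  show "adjacent_in A p q" using s unfolding A by (fastforce simp: adjacent_in_def sorted_wrt_append)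
  have "A - {p, q} = set (xs @ ys)" using s unfolding A by (fastforce simp: sorted_wrt_append)
  moreover have "sorted_wrt (<) (xs @ ys)" using s by (auto simp: sorted_wrt_append)
  ultimately show "sorted_list_of_set (A - {p, q}) = xs @ ys" using sorted_list_of_set_idem by metis
qed

lemma adjacent_sorted_list_of_set:
  assumes "finite A" "adjacent_in A p q"
  shows "\<exists>xs ys. sorted_list_of_set A = xs @ p # q # ys"
proof -
  let ?xs = "sorted_list_of_set {a \<in> A. a < p}" and ?ys = "sorted_list_of_set {a \<in> A. q < a}"
  have set: "set (?xs @ p # q # ?ys) = A"
    using assms by (auto simp: adjacent_in_def)
  have "sorted_wrt (<) (?xs @ p # q # ?ys)"
    using assms by (auto simp: adjacent_in_def sorted_wrt_append)
  from sorted_list_of_set_idem[OF this] have "sorted_list_of_set A = ?xs @ p # q # ?ys"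
    unfolding set .
  then show ?thesis by blast
qed

lemma not_successivelyD: "\<not> successively R us \<Longrightarrow> \<exists>xs x y ys. us = xs @ x # y # ys \<and> \<not> R x y"
proof (induction us)
  case (Cons u us)
  show ?case
  proof (cases us)
    case Nil
    with Cons.prems show ?thesis by simp
  next
    case (Cons v vs)
    show ?thesis
    proof (cases "R u v")
      case True
      then obtain xs x y ys where "us = xs @ x # y # ys" "\<not> R x y"
        using Cons.IH Cons.prems \<open>us = v # vs\<close> by auto
      then show ?thesis by (intro exI[of _ "u # xs"]) auto
    next
      case False
      then show ?thesis using \<open>us = v # vs\<close> by (intro exI[of _ "[]"]) auto
    qed
  qed
qed simp

text \<open>Induction on the number of positions. A reduced word admits only the empty partition of
  the empty set, of weight 1, or none at all; any other word has neighbouring inverse letters, whose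
  removal changes neither side.\<close>

lemma sum_alt_nc_partitions:
  assumes "finite A"
  shows "(\<Sum>P\<in>alt_nc_partitions l A. partition_weight P)
    = of_bool (foldr fg_cons (map l (sorted_list_of_set A)) [] = [])"
  using assms
proof (induction A rule: measure_induct_rule[of card])
  case (less A)
  show ?case
  proof (cases "reduced (map l (sorted_list_of_set A))")
    case True
    have eval: "foldr fg_cons (map l (sorted_list_of_set A)) [] = [] \<longleftrightarrow> A = {}"
      unfolding foldr_fg_cons_Nil[OF True] using less.prems by simp
    show ?thesis
    proof (cases "A = {}")
      case True
      then have "alt_nc_partitions l A = {{}}"
        by (auto simp: alt_nc_partitions_def partition_on_def disjoint_def)
      then show ?thesis using True by (simp add: partition_weight_def)
    next
      case False
      have "alt_nc_partitions l A = {}"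
      proof (rule ccontr)
        assume "alt_nc_partitions l A \<noteq> {}"
        then obtain p q where "adjacent_in A p q" "l q = letter_inv (l p)"
          using ex_adjacent_inverse False by blast
        moreover then obtain xs ys where "sorted_list_of_set A = xs @ p # q # ys"
          using adjacent_sorted_list_of_set less.prems by blast
        ultimately show False using True by (simp add: reduced_def successively_append_iff)
      qed
      then show ?thesis using False eval by simp
    qed
  next
    case False
    then obtain us x y vs where *: "map l (sorted_list_of_set A) = us @ x # y # vs" "y = letter_inv x"
      unfolding reduced_def using not_successivelyD by blast
    then obtain xs p q ys where split: "sorted_list_of_set A = xs @ p # q # ys"
      and l: "us = map l xs" "x = l p" "y = l q" "vs = map l ys"
      by (auto simp: map_eq_append_conv map_eq_Cons_conv)
    note adj = sorted_list_of_set_adjacent[OF less.prems split]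
    have inv: "l q = letter_inv (l p)" using * l by simp
    have "fg_cons (l p) (fg_cons (letter_inv (l p)) (foldr fg_cons (map l ys) [])) = foldr fg_cons (map l ys) []"
      by (rule fg_cons_cancel) (simp add: reduced_foldr)
    then have eval: "foldr fg_cons (map l (sorted_list_of_set A)) []
        = foldr fg_cons (map l (sorted_list_of_set (A - {p, q}))) []"
      unfolding split adj(2) by (simp add: inv)
    have "card (A - {p, q}) < card A"
      using adj(1) less.prems by (intro psubset_card_mono) (auto simp: adjacent_in_def)
    then have "(\<Sum>P\<in>alt_nc_partitions l (A - {p, q}). partition_weight P)
      = of_bool (foldr fg_cons (map l (sorted_list_of_set (A - {p, q}))) [] = [])"
      using less.IH less.prems by simp
    then show ?thesis
      unfolding eval using sum_alt_nc_partitions_cancel[OF less.prems adj(1) inv] by simp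
  qed
qed

section \<open>Star moments as numbers of colourings\<close>

definition colourings :: "nat \<Rightarrow> nat \<Rightarrow> nat list set" where
  "colourings d k = {c. length c = k \<and> set c \<subseteq> {1..d}}"

definition star_word :: "nat list \<Rightarrow> star_letter list \<Rightarrow> (nat \<times> bool) list" where
  "star_word c w = zip c (map (\<lambda>s. s = Plain) w)"

lemma finite_colourings: "finite (colourings d k)"
  using finite_lists_length_eq[of "{1..d}" k] by (simp add: colourings_def conj_commute)

text \<open>A starred step runs along an arc backwards, that is, it multiplies by an inverse
  generator. Both kinds of steps thus become right multiplication by a one-letter word.\<close>

lemma adjacency_letter_regular_tree:
  assumes v: "v \<in> carrier (free_group {1..d})" and v': "v' \<in> carrier (free_group {1..d})"
  shows "adjacency_letter (regular_tree d) s v v'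
    = of_bool (\<exists>i\<in>{1..d}. v' = v \<otimes>\<^bsub>free_group {1..d}\<^esub> [(i, s = Plain)])"
proof -
  let ?F = "free_group {1..d}"
  interpret group ?F by (rule group_free_group)
  have "v = v' \<otimes>\<^bsub>?F\<^esub> fg_gen i \<longleftrightarrow> v' = v \<otimes>\<^bsub>?F\<^esub> [(i, False)]" if "i \<in> {1..d}" for i
    using inv_solve_right[OF v' v fg_gen_closed[OF that]] inv_fg_gen[OF that] by simp
  then have star: "(\<exists>i\<in>{1..d}. v = v' \<otimes>\<^bsub>?F\<^esub> fg_gen i) \<longleftrightarrow> (\<exists>i\<in>{1..d}. v' = v \<otimes>\<^bsub>?F\<^esub> [(i, False)])"
    by (intro bex_cong refl)
  have arc: "(x, y) \<in> parcs (regular_tree d) \<longleftrightarrow> (\<exists>i\<in>{1..d}. y = x \<otimes>\<^bsub>?F\<^esub> fg_gen i)"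
    if "x \<in> carrier ?F" for x y
    using that by (auto simp: regular_tree_def cayley_digraph_def)
  show ?thesis
  proof (cases s)
    case Plain
    then show ?thesis using arc[OF v] by (simp add: adjacency_def fg_gen_def)
  next
    case Star
    then show ?thesis using arc[OF v'] star by (simp add: adjacency_def)
  qed
qed

text \<open>The vertex sequences whose product of matrix entries does not vanish.\<close>

definition walks :: "nat \<Rightarrow> star_letter list \<Rightarrow> (nat \<times> bool) list \<Rightarrow> (nat \<times> bool) list \<Rightarrow> (nat \<times> bool) list list set" where
  "walks d w v v' = {vs. length vs = Suc (length w) \<and> set vs \<subseteq> carrier (free_group {1..d}) \<and>
     vs ! 0 = v \<and> vs ! length w = v' \<and>
     (\<forall>j<length w. \<exists>i\<in>{1..d}. vs ! Suc j = vs ! j \<otimes>\<^bsub>free_group {1..d}\<^esub> [(i, w ! j = Plain)])}"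

lemma letter_closed: "i \<in> {1..d} \<Longrightarrow> [(i, b)] \<in> carrier (free_group {1..d})"
  by (simp add: free_group_def)

lemma walks_Cons:
  assumes "v \<in> carrier (free_group {1..d})"
  shows "walks d (s # w) v v' = (\<Union>i\<in>{1..d}. Cons v ` walks d w (v \<otimes>\<^bsub>free_group {1..d}\<^esub> [(i, s = Plain)]) v')"
proof (intro equalityI subsetI)
  fix vs assume "vs \<in> walks d (s # w) v v'"
  then have vs: "length vs = Suc (Suc (length w))" "set vs \<subseteq> carrier (free_group {1..d})"
    "vs ! 0 = v" "vs ! Suc (length w) = v'"
    and step: "\<And>j. j < Suc (length w) \<Longrightarrow> \<exists>i\<in>{1..d}. vs ! Suc j = vs ! j \<otimes>\<^bsub>free_group {1..d}\<^esub> [(i, (s # w) ! j = Plain)]"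
    by (auto simp: walks_def)
  then obtain us where us: "vs = v # us" "length us = Suc (length w)" by (cases vs) auto
  obtain i where i: "i \<in> {1..d}" "us ! 0 = v \<otimes>\<^bsub>free_group {1..d}\<^esub> [(i, s = Plain)]"
    using step[of 0] us by auto
  have "us \<in> walks d w (v \<otimes>\<^bsub>free_group {1..d}\<^esub> [(i, s = Plain)]) v'"
    using vs us i step[of "Suc _"] by (auto simp: walks_def)
  then show "vs \<in> (\<Union>i\<in>{1..d}. Cons v ` walks d w (v \<otimes>\<^bsub>free_group {1..d}\<^esub> [(i, s = Plain)]) v')"
    using us i by blast
next
  fix vs assume "vs \<in> (\<Union>i\<in>{1..d}. Cons v ` walks d w (v \<otimes>\<^bsub>free_group {1..d}\<^esub> [(i, s = Plain)]) v')"
  then obtain i us where "i \<in> {1..d}" "vs = v # us"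
    "us \<in> walks d w (v \<otimes>\<^bsub>free_group {1..d}\<^esub> [(i, s = Plain)]) v'" by blast
  then show "vs \<in> walks d (s # w) v v'"
    using assms by (auto simp: walks_def nth_Cons' less_Suc_eq_0_disj)
qed

text \<open>By left cancellation, the colour of each step is determined by its two end points, so
  walks from \<open>v\<close> correspond to colour sequences. The induction splits both sets by the
  first colour.\<close>

lemma card_walks:
  assumes "v \<in> carrier (free_group {1..d})"
  shows "finite (walks d w v v') \<and> card (walks d w v v') = card {c \<in> colourings d (length w).
    v \<otimes>\<^bsub>free_group {1..d}\<^esub> foldr fg_cons (star_word c w) [] = v'}"
  using assms
proof (induction w arbitrary: v)
  case Nil
  then have "walks d [] v v' = (if v = v' then {[v]} else {})"
    by (auto simp: walks_def length_Suc_conv)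
  moreover have "{c \<in> colourings d (length []). v \<otimes>\<^bsub>free_group {1..d}\<^esub> foldr fg_cons (star_word c []) [] = v'}
      = (if v = v' then {[]} else {})"
    using Nil by (auto simp: colourings_def star_word_def free_group_def foldr_fg_cons_Nil)
  ultimately show ?case by simp
next
  case (Cons s w)
  let ?F = "free_group {1..d}"
  interpret group ?F by (rule group_free_group)
  define g where "g i = v \<otimes>\<^bsub>?F\<^esub> [(i, s = Plain)]" for i
  define C where "C i = {c \<in> colourings d (length w). g i \<otimes>\<^bsub>?F\<^esub> foldr fg_cons (star_word c w) [] = v'}" for i
  have g: "g i \<in> carrier ?F" if "i \<in> {1..d}" for i
    unfolding g_def using Cons.prems letter_closed[OF that] by (rule m_closed)
  have g_inj: "i = j" if "i \<in> {1..d}" "j \<in> {1..d}" "g i = g j" for i j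
    using that Cons.prems letter_closed[OF that(1)] letter_closed[OF that(2)]
      Units_l_cancel[of v "[(i, s = Plain)]" "[(j, s = Plain)]"] Units_eq by (simp add: g_def)
  note IH = Cons.IH[OF g]
  have W: "walks d (s # w) v v' = (\<Union>i\<in>{1..d}. Cons v ` walks d w (g i) v')"
    using walks_Cons[OF Cons.prems] by (simp add: g_def)
  have "card (walks d (s # w) v v') = (\<Sum>i\<in>{1..d}. card (Cons v ` walks d w (g i) v'))"
    unfolding W
  proof (rule card_UN_disjoint)
    show "\<forall>i\<in>{1..d}. \<forall>j\<in>{1..d}. i \<noteq> j \<longrightarrow> Cons v ` walks d w (g i) v' \<inter> Cons v ` walks d w (g j) v' = {}"
      using g_inj by (auto simp: walks_def)
  qed (use IH in auto)
  also have "\<dots> = (\<Sum>i\<in>{1..d}. card (C i))"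
    using IH by (intro sum.cong) (auto simp: C_def card_image)
  also have "\<dots> = (\<Sum>i\<in>{1..d}. card (Cons i ` C i))"
    by (simp add: card_image)
  also have "\<dots> = card (\<Union>i\<in>{1..d}. Cons i ` C i)"
    by (rule card_UN_disjoint[symmetric]) (auto simp: C_def finite_colourings)
  also have "(\<Union>i\<in>{1..d}. Cons i ` C i) = {c \<in> colourings d (length (s # w)).
      v \<otimes>\<^bsub>?F\<^esub> foldr fg_cons (star_word c (s # w)) [] = v'}"
  proof -
    have eval: "v \<otimes>\<^bsub>?F\<^esub> foldr fg_cons (star_word (i # c) (s # w)) [] = g i \<otimes>\<^bsub>?F\<^esub> foldr fg_cons (star_word c w) []"
      for i c
      by (simp add: g_def free_group_def star_word_def foldr_fg_cons_assoc reduced_foldr)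
    have col: "i # c \<in> colourings d (length (s # w)) \<longleftrightarrow> i \<in> {1..d} \<and> c \<in> colourings d (length w)" for i c
      by (auto simp: colourings_def)
    have "\<exists>i c'. c = i # c'" if "c \<in> colourings d (length (s # w))" for c
      using that by (cases c) (auto simp: colourings_def)
    then show ?thesis using eval col by (fastforce simp: C_def)
  qed
  finally show ?case using IH unfolding W by auto
qed

text \<open>A product of 0/1 entries is the indicator of being a walk, so the moment counts closed
  walks at the root.\<close>

lemma star_moment_eq_card:
  "star_moment d w = card {c \<in> colourings d (length w). foldr fg_cons (star_word c w) [] = []}"
proof -
  let ?F = "free_group {1..d}" and ?T = "regular_tree d"
  interpret group ?F by (rule group_free_group)
  let ?prod = "\<lambda>vs. \<Prod>j<length w. adjacency_letter ?T (w ! j) (vs ! j) (vs ! Suc j)"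
  have verts: "pverts ?T = carrier ?F" by (simp add: regular_tree_def cayley_digraph_def)
  have prod: "?prod vs = of_bool (\<forall>j<length w. \<exists>i\<in>{1..d}. vs ! Suc j = vs ! j \<otimes>\<^bsub>?F\<^esub> [(i, w ! j = Plain)])"
    if "length vs = Suc (length w)" "set vs \<subseteq> carrier ?F" for vs
  proof -
    have "?prod vs = (\<Prod>j<length w. of_bool (\<exists>i\<in>{1..d}. vs ! Suc j = vs ! j \<otimes>\<^bsub>?F\<^esub> [(i, w ! j = Plain)]))"
    proof (rule prod.cong)
      fix j assume "j \<in> {..<length w}"
      then have "vs ! j \<in> carrier ?F" "vs ! Suc j \<in> carrier ?F"
        using that nth_mem[of j vs] nth_mem[of "Suc j" vs] by auto
      then show "adjacency_letter ?T (w ! j) (vs ! j) (vs ! Suc j)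
          = of_bool (\<exists>i\<in>{1..d}. vs ! Suc j = vs ! j \<otimes>\<^bsub>?F\<^esub> [(i, w ! j = Plain)])"
        by (rule adjacency_letter_regular_tree)
    qed simp
    also have "\<dots> = of_bool (\<forall>j\<in>{..<length w}. \<exists>i\<in>{1..d}. vs ! Suc j = vs ! j \<otimes>\<^bsub>?F\<^esub> [(i, w ! j = Plain)])"
      by (auto intro: prod_zero prod.neutral)
    finally show ?thesis by (simp add: Ball_def)
  qed
  have "star_moment d w = infsum ?prod {vs. length vs = Suc (length w) \<and> set vs \<subseteq> carrier ?F \<and>
      vs ! 0 = [] \<and> vs ! length w = []}"
    by (simp add: star_moment_def adjacency_word_def verts tree_root_def free_group_def)
  \<comment> \<open>The summand is 0 off \<open>walks\<close> and 1 on it; as this set is finite,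
    the infinite sum becomes its cardinality.\<close>
  also have "\<dots> = infsum (\<lambda>_. 1 :: real) (walks d w [] [])"
    by (rule infsum_cong_neutral) (auto simp: walks_def prod)
  also have "\<dots> = card (walks d w [] [])"
    using card_walks[of "[]" d w "[]"] by (simp add: free_group_def)
  also have "\<dots> = card {c \<in> colourings d (length w). foldr fg_cons (star_word c w) [] = []}"
    using card_walks[of "[]" d w "[]"] by (simp add: free_group_def)
  finally show ?thesis .
qed

section \<open>Colourings constant on blocks\<close>

definition block_constant :: "nat list \<Rightarrow> nat set set \<Rightarrow> bool" where
  "block_constant c P \<longleftrightarrow> (\<forall>V\<in>P. \<forall>i\<in>V. \<forall>j\<in>V. c ! (i - 1) = c ! (j - 1))"

text \<open>Such a colouring amounts to a free choice of one colour for every block.\<close>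

lemma card_block_constant_colourings:
  assumes P: "partition_on {1..k} P"
  shows "card {c \<in> colourings d k. block_constant c P} = d ^ card P"
proof -
  have fin: "finite P" using finite_elements[OF _ P] by simp
  have nonempty: "\<And>V. V \<in> P \<Longrightarrow> V \<noteq> {}" and sub: "\<And>V. V \<in> P \<Longrightarrow> V \<subseteq> {1..k}"
    using P by (auto simp: partition_on_def)
  note blk = block_of[OF P] and blkI = block_of_eqI[OF P]
  have "bij_betw (\<lambda>f. map (\<lambda>i. f (block_of P (Suc i))) [0..<k]) (P \<rightarrow>\<^sub>E {1..d})
      {c \<in> colourings d k. block_constant c P}"
  \<comment> \<open>The inverse map reads the colour of a block at its least position; the
    \<open>- 1\<close> passes from positions to list indices.\<close>
  proof (rule bij_betw_byWitness[of _ "\<lambda>c. \<lambda>V\<in>P. c ! (Min V - 1)"])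
    have Min: "Min V \<in> V" "Min V \<in> {1..k}" if "V \<in> P" for V
    proof -
      show "Min V \<in> V"
        using Min_in[of V] nonempty[OF that] sub[OF that] finite_subset[of V "{1..k}"] by auto
      then show "Min V \<in> {1..k}" using sub[OF that] by blast
    qed
    show "\<forall>f\<in>P \<rightarrow>\<^sub>E {1..d}. (\<lambda>V\<in>P. map (\<lambda>i. f (block_of P (Suc i))) [0..<k] ! (Min V - 1)) = f"
    proof
      fix f assume f: "f \<in> P \<rightarrow>\<^sub>E {1..d}"
      have "map (\<lambda>i. f (block_of P (Suc i))) [0..<k] ! (Min V - 1) = f V" if "V \<in> P" for V
      proof -
        have "Min V - 1 < k" "Suc (Min V - 1) = Min V" using Min(2)[OF that] by auto
        then show ?thesis using blkI[OF that Min(1)[OF that]] by simp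
      qed
      then show "(\<lambda>V\<in>P. map (\<lambda>i. f (block_of P (Suc i))) [0..<k] ! (Min V - 1)) = f"
        using f by (auto simp: fun_eq_iff PiE_def extensional_def)
    qed
    show "\<forall>c\<in>{c \<in> colourings d k. block_constant c P}.
        map (\<lambda>i. (\<lambda>V\<in>P. c ! (Min V - 1)) (block_of P (Suc i))) [0..<k] = c"
    proof
      fix c assume c: "c \<in> {c \<in> colourings d k. block_constant c P}"
      have "c ! (Min (block_of P (Suc i)) - 1) = c ! i" "block_of P (Suc i) \<in> P" if "i < k" for i
      proof -
        have *: "block_of P (Suc i) \<in> P" "Suc i \<in> block_of P (Suc i)" using blk[of "Suc i"] that by auto
        then show "block_of P (Suc i) \<in> P" by simp
        have "c ! (Min (block_of P (Suc i)) - 1) = c ! (Suc i - 1)"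
          using c * Min[OF *(1)] unfolding block_constant_def by blast
        then show "c ! (Min (block_of P (Suc i)) - 1) = c ! i" by simp
      qed
      then show "map (\<lambda>i. (\<lambda>V\<in>P. c ! (Min V - 1)) (block_of P (Suc i))) [0..<k] = c"
        using c by (auto intro!: nth_equalityI simp: colourings_def)
    qed
    show "(\<lambda>f. map (\<lambda>i. f (block_of P (Suc i))) [0..<k]) ` (P \<rightarrow>\<^sub>E {1..d})
        \<subseteq> {c \<in> colourings d k. block_constant c P}"
    proof (rule image_subsetI)
      fix f assume f: "f \<in> P \<rightarrow>\<^sub>E {1..d}"
      let ?c = "map (\<lambda>i. f (block_of P (Suc i))) [0..<k]"
      have "f (block_of P (Suc i)) \<in> {1..d}" if "i < k" for i
        using f blk[of "Suc i"] that by auto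
      then have "?c \<in> colourings d k" by (auto simp: colourings_def)
      moreover have "?c ! (i - 1) = f V" if "V \<in> P" "i \<in> V" for i V
      proof -
        have "i \<in> {1..k}" using sub that by blast
        then have "i - 1 < k" "Suc (i - 1) = i" by auto
        then show ?thesis using blkI[OF that] by simp
      qed
      then have "block_constant ?c P" by (simp add: block_constant_def)
      ultimately show "?c \<in> {c \<in> colourings d k. block_constant c P}" by blast
    qed
    show "(\<lambda>c. \<lambda>V\<in>P. c ! (Min V - 1)) ` {c \<in> colourings d k. block_constant c P} \<subseteq> P \<rightarrow>\<^sub>E {1..d}"
    proof (rule image_subsetI)
      fix c assume c: "c \<in> {c \<in> colourings d k. block_constant c P}"
      have "c ! (Min V - 1) \<in> {1..d}" if "V \<in> P" for V
      proof -
        have "Min V - 1 < length c" using Min(2)[OF that] c by (auto simp: colourings_def)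
        then have "c ! (Min V - 1) \<in> set c" by (rule nth_mem)
        then show ?thesis using c by (auto simp: colourings_def)
      qed
      then show "(\<lambda>V\<in>P. c ! (Min V - 1)) \<in> P \<rightarrow>\<^sub>E {1..d}" by (simp add: PiE_def)
    qed
  qed
  from bij_betw_same_card[OF this] show ?thesis
    using card_PiE[OF fin, of "\<lambda>_. {1..d}"] by simp
qed

section \<open>From labelled blocks to alternating non-crossing partitions\<close>

lemma concat_replicate_pair:
  "length (concat (replicate n [a, b])) = 2 * n"
  "i < 2 * n \<Longrightarrow> concat (replicate n [a, b]) ! i = (if even i then a else b)"
proof (induction n arbitrary: i)
  case (Suc n)
  {
    case 1 then show ?case using Suc.IH(1) by simp
  next
    case 2
    then consider "i = 0" | "i = 1" | j where "i = Suc (Suc j)" "j < 2 * n"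
      by (cases i; cases "i - 1") auto
    then show ?case using Suc.IH(2) by cases auto
  }
qed auto

text \<open>A pointwise form, comparable with \<open>alternates\<close>; for a nonempty word,
  \<open>t\<close> tells whether the first letter is \<open>Plain\<close>.\<close>

lemma alternating_iff:
  "alternating u \<longleftrightarrow> even (length u) \<and> (\<exists>t. \<forall>i<length u. (u ! i = Plain) = (t = even i))"
proof
  assume "alternating u"
  then obtain n where "u = concat (replicate n [Plain, Star]) \<or> u = concat (replicate n [Star, Plain])"
    unfolding alternating_def by blast
  then show "even (length u) \<and> (\<exists>t. \<forall>i<length u. (u ! i = Plain) = (t = even i))"
  proof
    assume "u = concat (replicate n [Plain, Star])"
    then show ?thesis
      by (simp only: concat_replicate_pair(1)) (auto simp: concat_replicate_pair intro!: exI[of _ True])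
  next
    assume "u = concat (replicate n [Star, Plain])"
    then show ?thesis
      by (simp only: concat_replicate_pair(1)) (auto simp: concat_replicate_pair intro!: exI[of _ False])
  qed
next
  assume "even (length u) \<and> (\<exists>t. \<forall>i<length u. (u ! i = Plain) = (t = even i))"
  then obtain n t where n: "length u = 2 * n" and t: "\<And>i. i < 2 * n \<Longrightarrow> (u ! i = Plain) = (t = even i)"
    by (auto elim!: evenE)
  have star: "s = Star \<longleftrightarrow> s \<noteq> Plain" for s by (cases s) auto
  have "u = concat (replicate n (if t then [Plain, Star] else [Star, Plain]))"
    by (rule nth_equalityI) (use n t in \<open>auto simp: concat_replicate_pair star\<close>)
  then show "alternating u" unfolding alternating_def by (cases t) auto
qed

lemma rank_in_sorted_list:
  assumes "finite V" "i < card V"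
  shows "rank_in V (sorted_list_of_set V ! i) = i"
proof -
  let ?xs = "sorted_list_of_set V"
  have nth: "?xs ! j < ?xs ! m \<longleftrightarrow> j < m" if "j < card V" "m < card V" for j m
    using that sorted_wrt_nth_less[OF strict_sorted_list_of_set[of V], of j m]
      sorted_wrt_nth_less[OF strict_sorted_list_of_set[of V], of m j]
    by (cases j m rule: linorder_cases) auto
  have V: "V = (!) ?xs ` {..<card V}"
    using assms(1) set_sorted_list_of_set[of V] by (metis length_sorted_list_of_set lessThan_atLeast0 nth_image order_refl take_all)
  have "V \<inter> {..<?xs ! i} = (!) ?xs ` {..<i}"
    by (subst V) (use nth assms(2) in auto)
  moreover have "inj_on ((!) ?xs) {..<i}"
    using assms(2) by (auto simp: inj_on_def nth_eq_iff_index_eq)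
  ultimately show ?thesis by (simp add: rank_in_def card_image)
qed

definition label :: "nat list \<Rightarrow> star_letter list \<Rightarrow> nat \<Rightarrow> nat \<times> bool" where
  "label c w i = (c ! (i - 1), w ! (i - 1) = Plain)"

text \<open>The starting letter is a pair of a colour \<open>e\<close> and a flag \<open>t\<close>.
  Passing to the inverse affects only the flag, so the condition separates into one on the colours
  and one on the star word.\<close>

lemma alternates_label_iff:
  assumes "finite V"
  shows "alternates (label c w) V \<longleftrightarrow>
    alternating (subword w V) \<and> (\<forall>i\<in>V. \<forall>j\<in>V. c ! (i - 1) = c ! (j - 1))"
proof -
  let ?xs = "sorted_list_of_set V"
  have ball: "(\<forall>a\<in>V. Q a) \<longleftrightarrow> (\<forall>i<card V. Q (?xs ! i))" for Q
    using assms by (metis in_set_conv_nth length_sorted_list_of_set set_sorted_list_of_set)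
  have "alternates (label c w) V \<longleftrightarrow>
      even (card V) \<and> (\<exists>x. \<forall>i<card V. label c w (?xs ! i) = alternate x i)"
    unfolding alternates_def ball using assms by (simp add: rank_in_sorted_list)
  also have "\<dots> \<longleftrightarrow> even (card V) \<and> (\<exists>e t. \<forall>i<card V. c ! (?xs ! i - 1) = e \<and>
      (w ! (?xs ! i - 1) = Plain) = (t = even i))"
  proof -
    have "label c w a = alternate (e, t) i \<longleftrightarrow> c ! (a - 1) = e \<and> (w ! (a - 1) = Plain) = (t = even i)"
      for a e t i
      by (auto simp: label_def alternate_def letter_inv_def)
    then show ?thesis by (simp only: split_paired_Ex)
  qed
  also have "\<dots> \<longleftrightarrow> even (card V) \<and> (\<exists>t. \<forall>i<card V. (w ! (?xs ! i - 1) = Plain) = (t = even i)) \<and>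
      (\<exists>e. \<forall>i\<in>V. c ! (i - 1) = e)"
  proof -
    have "(\<exists>e t. \<forall>i<n. R e i \<and> T t i) \<longleftrightarrow> (\<exists>t. \<forall>i<n. T t i) \<and> (\<exists>e. \<forall>i<n. R e i)"
      for n :: nat and R :: "nat \<Rightarrow> nat \<Rightarrow> bool" and T :: "bool \<Rightarrow> nat \<Rightarrow> bool"
      by blast
    then show ?thesis unfolding ball by simp
  qed
  also have "(\<exists>e. \<forall>i\<in>V. c ! (i - 1) = e) \<longleftrightarrow> (\<forall>i\<in>V. \<forall>j\<in>V. c ! (i - 1) = c ! (j - 1))" by metis
  finally show ?thesis
    by (simp add: alternating_iff subword_def)
qed

text \<open>Requiring \<open>j1\<close> and \<open>i2\<close> to share a block forces the two blocks
  involved to coincide, so the condition on four positions fails exactly when distinct blocks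
  cross.\<close>

lemma non_crossing_iff:
  assumes "partition_on {1..k} P"
  shows "non_crossing k P \<longleftrightarrow> (\<forall>V\<in>P. \<forall>W\<in>P. V \<noteq> W \<longrightarrow> \<not> crossing V W)"
proof
  assume nc: "non_crossing k P"
  show "\<forall>V\<in>P. \<forall>W\<in>P. V \<noteq> W \<longrightarrow> \<not> crossing V W"
  proof (intro ballI impI notI)
    fix V W assume VW: "V \<in> P" "W \<in> P" "V \<noteq> W" "crossing V W"
    then obtain a b c d where *: "a \<in> V" "b \<in> W" "c \<in> V" "d \<in> W" "a < b" "b < c" "c < d"
      unfolding crossing_def by blast
    have "1 \<le> a" "d \<le> k" using assms VW * by (force simp: partition_on_def)+
    moreover have "same_block P a c" "same_block P b d" using VW * by (auto simp: same_block_def)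
    ultimately have "same_block P c b" using nc * unfolding non_crossing_def by blast
    then obtain X where "X \<in> P" "c \<in> X" "b \<in> X" by (auto simp: same_block_def)
    then have "X = V" "X = W" using VW * block_of_eqI[OF assms] by metis+
    then show False using VW by simp
  qed
next
  assume nc: "\<forall>V\<in>P. \<forall>W\<in>P. V \<noteq> W \<longrightarrow> \<not> crossing V W"
  have "same_block P c b" if less: "a < b" "b < c" "c < d" and same: "same_block P a c" "same_block P b d" for a b c d
  proof -
    obtain V W where VW: "V \<in> P" "a \<in> V" "c \<in> V" "W \<in> P" "b \<in> W" "d \<in> W"
      using same unfolding same_block_def by blast
    then have "V = W" using nc crossingI[of a V b W c d] less by blast
    then show ?thesis using VW by (auto simp: same_block_def)
  qed
  then show "non_crossing k P" using assms unfolding non_crossing_def by blast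
qed

lemma alt_nc_partitions_label_iff:
  "P \<in> alt_nc_partitions (label c w) {1..length w} \<longleftrightarrow> P \<in> ANC w \<and> block_constant c P"
proof (cases "partition_on {1..length w} P")
  case True
  then have "V \<subseteq> {1..length w}" if "V \<in> P" for V
    using that unfolding partition_on_def by blast
  then have "finite V" if "V \<in> P" for V
    using that finite_subset by blast
  then have "(\<forall>V\<in>P. alternates (label c w) V) \<longleftrightarrow> (\<forall>V\<in>P. alternating (subword w V)) \<and> block_constant c P"
    unfolding block_constant_def ball_conj_distrib[symmetric]
    by (intro ball_cong refl alternates_label_iff)
  then show ?thesis
    using True by (simp add: alt_nc_partitions_def ANC_def non_crossing_iff conj_assoc)
next
  case False
  then show ?thesis by (simp add: alt_nc_partitions_def ANC_def non_crossing_def)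
qed

lemma map_label:
  assumes "length c = length w"
  shows "map (label c w) (sorted_list_of_set {1..length w}) = star_word c w"
proof -
  have "sorted_list_of_set {1..length w} = [1..<Suc (length w)]"
    using sorted_list_of_set_range[of 1 "Suc (length w)"] by (simp only: atLeastLessThanSuc_atLeastAtMost)
  then show ?thesis
    using assms by (auto intro!: nth_equalityI simp: label_def star_word_def simp del: upt_Suc)
qed

section \<open>Double counting of colourings and partitions\<close>

theorem theorem3:
  fixes d k :: nat and w :: "star_letter list"
  assumes "d \<ge> 2" and "length w = k"
  shows "star_moment d w =
    (\<Sum>P \<in> ANC w.
       (\<Prod>V\<in>P. (- 1) ^ (card V div 2 - 1) * catalan (card V div 2 - 1)) * real d ^ card P)"
proof -
  have "star_moment d w = (\<Sum>c\<in>colourings d k. of_bool (foldr fg_cons (star_word c w) [] = []))"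
    unfolding star_moment_eq_card assms(2) of_bool_def
    by (subst sum.inter_filter[OF finite_colourings, symmetric]) simp
  also have "\<dots> = (\<Sum>c\<in>colourings d k. \<Sum>P\<in>alt_nc_partitions (label c w) {1..k}. partition_weight P)"
  proof (rule sum.cong)
    fix c assume "c \<in> colourings d k"
    then have "map (label c w) (sorted_list_of_set {1..k}) = star_word c w"
      using map_label[of c w] assms(2) by (simp add: colourings_def)
    then show "of_bool (foldr fg_cons (star_word c w) [] = [])
        = (\<Sum>P\<in>alt_nc_partitions (label c w) {1..k}. partition_weight P)"
      unfolding sum_alt_nc_partitions[OF finite_atLeastAtMost] by (simp only:)
  qed simp
  also have "\<dots> = (\<Sum>c\<in>colourings d k. \<Sum>P | P \<in> ANC w \<and> block_constant c P. partition_weight P)"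
  proof (rule sum.cong)
    fix c
    have "alt_nc_partitions (label c w) {1..k} = {P. P \<in> ANC w \<and> block_constant c P}"
      using alt_nc_partitions_label_iff[of _ c w] unfolding assms(2) by blast
    then show "(\<Sum>P\<in>alt_nc_partitions (label c w) {1..k}. partition_weight P)
        = (\<Sum>P | P \<in> ANC w \<and> block_constant c P. partition_weight P)"
      by (simp only:)
  qed simp
  \<comment> \<open>After the exchange the weight is constant in the inner sum, which therefore only
    counts the colourings constant on the blocks of \<open>P\<close>.\<close>
  also have "\<dots> = (\<Sum>P\<in>ANC w. \<Sum>c | c \<in> colourings d k \<and> block_constant c P. partition_weight P)"
    by (rule sum.swap_restrict[OF finite_colourings finite_ANC])
  also have "\<dots> = (\<Sum>P\<in>ANC w. partition_weight P * real d ^ card P)"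
  proof (rule sum.cong)
    fix P assume "P \<in> ANC w"
    then have "partition_on {1..k} P" using assms(2) by (simp add: ANC_def non_crossing_def)
    then show "(\<Sum>c | c \<in> colourings d k \<and> block_constant c P. partition_weight P) = partition_weight P * real d ^ card P"
      by (simp add: card_block_constant_colourings)
  qed simp
  finally show ?thesis by (simp add: partition_weight_def signed_catalan_def)
qed

end
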